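(* $$\limsup_{n\to\infty}\frac{\varrho(n)\sigma(n)}{n^2\log\log n}=\limsup_{n\to\infty}\frac{\varrho(n)\psi(n)}{n^2\log\log n}=\frac{6}{\pi^2}e^{\gamma},$$ where $\gamma$ is the Euler–Mascheroni constant.
   Context: An integer $k$ is called regular (mod $n$) if there exists $x\in\mathbb{Z}$ with $k^2x\equiv k\pmod n$, and $\varrho(n)$ is the number of integers $k\in\{1,\ldots,n\}$ that are regular (mod $n$). $\sigma(n)$ is the sum of the positive divisors of $n$, and $\psi(n)=n\prod_{p\mid n}(1+1/p)$ (product over primes) is the Dedekind function. *)

theory Defs
  imports "HOL-Analysis.Analysis" "HOL-Number_Theory.Cong"
begin

definition regular_mod :: "nat \<Rightarrow> int \<Rightarrow> bool" where
  "regular_mod n k \<longleftrightarrow> (\<exists>x::int. [k\<^sup>2 * x = k] (mod int n))"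

definition varrho :: "nat \<Rightarrow> nat" where
  "varrho n = card {k \<in> {1..int n}. regular_mod n k}"

(* Intended for n > 0; for n = 0 the index set is infinite and the sum is 0. *)
definition divisor_sum :: "nat \<Rightarrow> nat" where
  "divisor_sum n = (\<Sum>d | d dvd n. d)"

(* Integer-valued, but defined over the reals because of the factors 1 + 1/p. *)
definition dedekind_psi :: "nat \<Rightarrow> real" where
  "dedekind_psi n = real n * (\<Prod>p\<in>prime_factors n. 1 + 1 / real p)"

end

theory Submission
  imports Defs "HOL-Number_Theory.Number_Theory" "HOL-Computational_Algebra.Squarefree"
    "HOL-Real_Asymp.Real_Asymp"
begin

text \<open>
  On prime powers both quotients, divided by $n^2$, are at most $1 + 1/p$, with equality for
  exponent one, so the problem reduces to the extremal order of $\prod_{p \mid n} (1 + 1/p)$.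
  The primes $p > \ln n$ dividing $n$ number at most $\ln n / \ln\ln n$ and contribute a factor
  $1 + o(1)$, hence everything follows from Mertens' third theorem; the primorials attain the bound,
  for which the trivial estimate $\prod_{p \le N} p \le N^N$ suffices.

  Mertens' theorem with its constant comes from a Karamata-type comparison of two measures: the
  masses $-\ln(1 - 1/p)$ at the points $\ln p$, and the masses $1/n$ at the points $n$. Both have
  Laplace transform $-\ln d + o(1)$ as $d \to 0^+$, so polynomial approximation of a step function
  forces their distribution functions to agree up to $o(1)$, and the second one is the harmonic
  series, which produces the Euler-Mascheroni constant without evaluating any integral.
\<close>

section \<open>Regular residues and divisor sums\<close>

lemma regular_mod_cong:
  assumes "[k = l] (mod int n)"
  shows "regular_mod n k \<longleftrightarrow> regular_mod n l"
proof -
  have "[k\<^sup>2 * x = l\<^sup>2 * x] (mod int n)" for x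
    using assms by (intro cong_mult cong_pow cong_refl)
  thus ?thesis
    unfolding regular_mod_def using assms by (meson cong_sym cong_trans)
qed

lemma regular_mod_dvd:
  assumes "regular_mod n k" "m dvd n"
  shows "regular_mod m k"
  using assms unfolding regular_mod_def by (meson cong_dvd_modulus int_dvd_int_iff)

text \<open>The residues below \<open>n\<close> are the values of \<open>mod\<close>, which the
  Chinese remainder map below produces; the representative \<open>n\<close> is traded for 0.\<close>

lemma varrho_eq_card_residues:
  assumes "n > 0"
  shows "varrho n = card {k \<in> {0..<int n}. regular_mod n k}"
  unfolding varrho_def
proof (rule bij_betw_same_card[symmetric],
       rule bij_betw_byWitness[where f = "\<lambda>k. if k = 0 then int n else k"
                                 and f' = "\<lambda>k. if k = int n then 0 else k"])
  have *: "regular_mod n (int n) \<longleftrightarrow> regular_mod n 0"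
    by (rule regular_mod_cong) (simp add: cong_def)
  show "(\<lambda>k. if k = 0 then int n else k) ` {k \<in> {0..<int n}. regular_mod n k}
          \<subseteq> {k \<in> {1..int n}. regular_mod n k}"
    using assms * by auto
  show "(\<lambda>k. if k = int n then 0 else k) ` {k \<in> {1..int n}. regular_mod n k}
          \<subseteq> {k \<in> {0..<int n}. regular_mod n k}"
    using assms * by auto
qed (use assms in auto)

lemma varrho_le: "varrho n \<le> n"
proof -
  have "varrho n \<le> card {1..int n}"
    unfolding varrho_def by (rule card_mono) auto
  thus ?thesis by simp
qed

text \<open>Regularity passes to every divisor of the modulus, so the Chinese remainder map sends
  regular residues mod \<open>m * n\<close> to pairs of regular residues; its injectivity gives the
  bound.\<close>

lemma varrho_mult_le:
  assumes "coprime m n" "m > 0" "n > 0"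
  shows "varrho (m * n) \<le> varrho m * varrho n"
proof -
  let ?R = "\<lambda>n. {k \<in> {0..<int n}. regular_mod n k}"
  let ?f = "\<lambda>k::int. (k mod int m, k mod int n)"
  have "inj_on ?f (?R (m * n))"
  proof (rule inj_onI)
    fix k l assume k: "k \<in> ?R (m * n)" and l: "l \<in> ?R (m * n)" and eq: "?f k = ?f l"
    have "[k = l] (mod int m)" "[k = l] (mod int n)"
      using eq by (auto simp: cong_def)
    hence "[k = l] (mod (int m * int n))"
      using assms by (simp add: coprime_cong_mult)
    thus "k = l" using k l by (auto simp: cong_def)
  qed
  moreover have "?f ` ?R (m * n) \<subseteq> ?R m \<times> ?R n"
  proof safe
    fix k assume k: "regular_mod (m * n) k"
    have "regular_mod m k" "regular_mod n k"
      using k by (auto intro: regular_mod_dvd)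
    moreover have "[k mod int m = k] (mod int m)" "[k mod int n = k] (mod int n)"
      by (simp_all add: cong_def)
    ultimately show "regular_mod m (k mod int m)" "regular_mod n (k mod int n)"
      using regular_mod_cong by blast+
  qed (use assms in auto)
  moreover have "finite (?R m \<times> ?R n)"
    by (intro finite_cartesian_product) (rule finite_subset[of _ "{0..<int _}"]; force)+
  ultimately have "card (?R (m * n)) \<le> card (?R m \<times> ?R n)"
    by (meson card_inj_on_le)
  thus ?thesis using assms by (simp add: varrho_eq_card_residues card_cartesian_product)
qed

text \<open>A regular \<open>k\<close> that is not a unit is divisible by \<open>p\<close>, so
  \<open>k * x - 1\<close> is coprime to \<open>p\<close>. Then \<open>p ^ a\<close> dividing
  \<open>k * (k * x - 1)\<close> must divide \<open>k\<close>, which leaves only the zero class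
  beside the units.\<close>

lemma varrho_prime_power_le:
  assumes "prime p" "a > 0"
  shows "varrho (p ^ a) \<le> totient (p ^ a) + 1"
proof -
  have "{k \<in> {1..int (p ^ a)}. regular_mod (p ^ a) k} \<subseteq> insert (int (p ^ a)) (int ` totatives (p ^ a))"
  proof safe
    fix k :: int
    assume k: "k \<in> {1..int (p ^ a)}" "regular_mod (p ^ a) k" "k \<notin> int ` totatives (p ^ a)"
    have "\<not> coprime (nat k) (p ^ a)"
    proof
      assume "coprime (nat k) (p ^ a)"
      hence "nat k \<in> totatives (p ^ a)"
        using k(1) by (auto simp: in_totatives_iff nat_le_iff)
      hence "int (nat k) \<in> int ` totatives (p ^ a)" by blast
      thus False using k by auto
    qed
    hence "\<not> coprime (nat k) p"
      using assms(2) by simp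
    hence "p dvd nat k"
      using assms(1) by (metis coprime_commute prime_imp_coprime_nat)
    hence pk: "int p dvd k"
      using k(1) by (metis atLeastAtMost_iff int_dvd_int_iff int_nat_eq order_trans zero_le_one)
    obtain x where "[k\<^sup>2 * x = k] (mod int (p ^ a))"
      using k(2) by (auto simp: regular_mod_def)
    hence "int p ^ a dvd k * (k * x - 1)"
      by (simp add: cong_iff_dvd_diff algebra_simps power2_eq_square)
    moreover have "coprime (int p) (k * x - 1)"
    proof (rule coprimeI)
      fix c assume c: "c dvd int p" "c dvd k * x - 1"
      hence "c dvd k * x" using pk by (meson dvd_mult2 dvd_trans)
      hence "c dvd k * x - (k * x - 1)" using c(2) by (rule dvd_diff)
      also have "k * x - (k * x - 1) = 1" by simp
      finally show "is_unit c" .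
    qed
    hence "coprime (int p ^ a) (k * x - 1)" by simp
    ultimately have "int p ^ a dvd k"
      by (simp add: coprime_dvd_mult_left_iff)
    hence "int (p ^ a) \<le> k" using k(1) by (auto intro!: zdvd_imp_le)
    thus "k = int (p ^ a)" using k(1) by simp
  qed
  hence "varrho (p ^ a) \<le> card (insert (int (p ^ a)) (int ` totatives (p ^ a)))"
    unfolding varrho_def by (intro card_mono) auto
  also have "\<dots> \<le> Suc (card (int ` totatives (p ^ a)))"
    by (rule card_insert_le_m1) auto
  also have "card (int ` totatives (p ^ a)) = totient (p ^ a)"
    by (simp add: card_image totient_def)
  finally show ?thesis by simp
qed

text \<open>Write \<open>d = g * e\<close> and \<open>k = g * l\<close> with
  \<open>g = gcd d k\<close> and \<open>e\<close>, \<open>l\<close> coprime. Then \<open>e\<close>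
  divides \<open>g * l\<^sup>2\<close>, hence \<open>g\<close>, so \<open>e\<^sup>2\<close> divides
  \<open>d\<close> and \<open>e\<close> is a unit.\<close>

lemma squarefree_dvd_square:
  fixes d k :: int
  assumes "squarefree d" "d dvd k\<^sup>2"
  shows "d dvd k"
proof -
  have "d \<noteq> 0" using assms by auto
  then obtain e l where el: "d = gcd d k * e" "k = gcd d k * l" "coprime e l"
    by (metis gcd_coprime_exists gcd_eq_0_iff mult.commute)
  define g where "g = gcd d k"
  have "g \<noteq> 0" using \<open>d \<noteq> 0\<close> by (simp add: g_def)
  have "g * e dvd g * (g * l\<^sup>2)"
    using assms(2) el(1,2) by (metis g_def mult.assoc mult.left_commute power2_eq_square)
  hence "e dvd g * l\<^sup>2" using \<open>g \<noteq> 0\<close> by simp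
  hence "e dvd g" using el(3) by (simp add: coprime_dvd_mult_left_iff)
  hence "e\<^sup>2 dvd d" using el(1) by (metis g_def mult_dvd_mono dvd_refl power2_eq_square)
  hence "is_unit e" using assms(1) squarefreeD by blast
  thus ?thesis using el(1) by (metis dvd_mult_unit_iff dvd_refl gcd_dvd2 dvd_trans)
qed

text \<open>Here \<open>d = gcd (k\<^sup>2) n\<close> is squarefree and divides
  \<open>k\<^sup>2\<close>, hence \<open>k\<close>. Bezout solves \<open>k\<^sup>2 * x = d\<close>
  mod \<open>n\<close>, and multiplying by \<open>k / d\<close> gives regularity of every
  \<open>k\<close>.\<close>

lemma varrho_squarefree:
  assumes "squarefree n"
  shows "varrho n = n"
proof -
  have "regular_mod n k" for k
  proof -
    define d where "d = gcd (k\<^sup>2) (int n)"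
    have "squarefree (int n)"
    proof (rule squarefreeI)
      fix x :: int assume "x\<^sup>2 dvd int n"
      hence "(nat \<bar>x\<bar>)\<^sup>2 dvd n"
        by (metis abs_ge_zero int_dvd_int_iff nat_0_le of_nat_power power2_abs)
      hence "nat \<bar>x\<bar> = 1" using assms squarefreeD nat_dvd_1_iff_1 by blast
      hence "\<bar>x\<bar> = 1" by simp
      thus "is_unit x" by simp
    qed
    hence "squarefree d" unfolding d_def by (meson gcd_dvd2 squarefree_mono)
    moreover have "d dvd k\<^sup>2" by (simp add: d_def)
    ultimately have "d dvd k"
      by (rule squarefree_dvd_square)
    then obtain c where c: "k = d * c" by auto
    obtain x where "[k\<^sup>2 * x = d] (mod int n)"
      using cong_solve_int[of "k\<^sup>2" "int n"] by (auto simp: d_def)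
    hence "[k\<^sup>2 * x * c = k] (mod int n)"
      using cong_scalar_right[of _ _ _ c] c by blast
    thus ?thesis unfolding regular_mod_def by (metis mult.assoc)
  qed
  hence "{k \<in> {1..int n}. regular_mod n k} = {1..int n}" by auto
  thus ?thesis by (simp add: varrho_def)
qed

text \<open>A divisor of \<open>m * n\<close> splits uniquely into a divisor of \<open>m\<close> and
  a divisor of \<open>n\<close>.\<close>

lemma divisor_sum_mult:
  assumes "coprime m n" "m > 0" "n > 0"
  shows "divisor_sum (m * n) = divisor_sum m * divisor_sum n"
proof -
  have "divisor_sum m * divisor_sum n = (\<Sum>(d, e)\<in>{d. d dvd m} \<times> {e. e dvd n}. d * e)"
    unfolding divisor_sum_def by (simp add: sum_product sum.cartesian_product)
  also have "\<dots> = (\<Sum>p\<in>{d. d dvd m} \<times> {e. e dvd n}. fst p * snd p)"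
    by (simp add: case_prod_unfold)
  also have "\<dots> = divisor_sum (m * n)" unfolding divisor_sum_def
  proof (rule sum.reindex_bij_betw)
    show "bij_betw (\<lambda>p. fst p * snd p) ({d. d dvd m} \<times> {e. e dvd n}) {d. d dvd m * n}"
      unfolding bij_betw_def
    proof
      show "inj_on (\<lambda>p. fst p * snd p) ({d. d dvd m} \<times> {e. e dvd n})"
      proof (rule inj_onI, clarsimp)
        fix a b c d assume *: "a dvd m" "b dvd n" "c dvd m" "d dvd n" "a * b = c * d"
        \<comment> \<open>Divisors taken from different sides are coprime, so
          \<open>a * b = c * d\<close> forces \<open>a\<close> and \<open>c\<close> to divide each
          other.\<close>
        have "coprime a d" "coprime c b" "coprime a b" "coprime c d"
          using assms * by (meson coprime_divisors)+
        hence "a dvd c" "c dvd a"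
          using *(5) by (metis coprime_dvd_mult_left_iff dvd_triv_left)+
        hence "a = c" by (simp add: dvd_antisym)
        moreover have "a > 0" using * assms by (auto intro!: Nat.gr0I)
        ultimately show "a = c \<and> b = d" using *(5) by auto
      qed
      show "(\<lambda>p. fst p * snd p) ` ({d. d dvd m} \<times> {e. e dvd n}) = {d. d dvd m * n}"
      proof safe
        fix d assume "d dvd m * n"
        then obtain x y where "d = x * y" "x dvd m" "y dvd n"
          by (rule dvd_productE)
        thus "d \<in> (\<lambda>p. fst p * snd p) ` ({d. d dvd m} \<times> {e. e dvd n})" by force
      qed (auto intro: mult_dvd_mono)
    qed
  qed
  finally show ?thesis ..
qed

lemma divisor_sum_prime_power:
  assumes "prime p"
  shows "divisor_sum (p ^ a) = (\<Sum>i\<le>a. p ^ i)"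
proof -
  have "{d. d dvd p ^ a} = (\<lambda>i. p ^ i) ` {..a}"
    using assms by (auto simp: divides_primepow_nat)
  moreover have "inj_on (\<lambda>i. p ^ i) {..a}"
    using assms by (intro inj_onI) (metis prime_gt_1_nat power_inject_exp)
  ultimately show ?thesis unfolding divisor_sum_def by (simp add: sum.reindex)
qed

section \<open>The local bound at prime powers and its extension to all integers\<close>

text \<open>For \<open>q = 1 / p\<close> the left side is the normalised bound at
  \<open>p ^ a\<close>. Multiplying by \<open>1 - q\<close> collapses the geometric sum, and the gap
  becomes a product of nonnegative factors: the last one is nonnegative because
  \<open>q ^ Suc a \<le> q \<le> 1 / 2\<close>. For \<open>a = 1\<close> the gap vanishes.\<close>

lemma local_factor_le:
  fixes q :: real
  assumes "0 \<le> q" "q \<le> 1 / 2" "a > 0"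
  shows "(1 - q + q ^ a) * (\<Sum>i\<le>a. q ^ i) \<le> 1 + q"
proof -
  obtain b where a: "a = Suc b" using assms(3) gr0_implies_Suc by blast
  have *: "(1 - q) * (\<Sum>i\<le>a. q ^ i) = 1 - q ^ Suc a"
    using sum_gp_basic[of q a] by simp
  have "q ^ Suc a \<le> q" using power_decreasing[of 1 "Suc a" q] assms by simp
  hence "0 \<le> q * (1 - q ^ b) * (1 - q - q ^ Suc a)"
    using assms by (intro mult_nonneg_nonneg) (auto simp: power_le_one)
  also have "\<dots> = (1 - q) * (1 + q) - (1 - q + q ^ a) * (1 - q ^ Suc a)"
    by (simp add: a algebra_simps)
  also have "\<dots> = (1 - q) * (1 + q) - (1 - q + q ^ a) * ((1 - q) * (\<Sum>i\<le>a. q ^ i))"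
    by (simp only: *)
  also have "\<dots> = (1 - q) * ((1 + q) - (1 - q + q ^ a) * (\<Sum>i\<le>a. q ^ i))"
    by (simp only: right_diff_distrib mult_ac)
  finally show ?thesis
    using assms by (simp add: zero_le_mult_iff)
qed

text \<open>With \<open>q = 1 / p\<close>, both the bound \<open>totient (p ^ a) + 1\<close> and the
  divisor sum are \<open>p ^ a\<close> times an expression in \<open>q\<close>, which reduces the
  claim to \<open>local_factor_le\<close>.\<close>

lemma varrho_divisor_sum_prime_power_le:
  assumes "prime p" "a > 0"
  shows "real (varrho (p ^ a)) * real (divisor_sum (p ^ a)) \<le> real (p ^ a) ^ 2 * (1 + 1 / real p)"
proof -
  define q where "q = 1 / real p"
  have p: "real p \<ge> 2" using prime_ge_2_nat[OF assms(1)] by simp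
  have q: "0 \<le> q" "q \<le> 1 / 2" using p by (auto simp: q_def field_simps)
  obtain b where a: "a = Suc b" using assms(2) gr0_implies_Suc by blast
  have pq: "real p * q = 1" using p by (simp add: q_def)
  hence pq': "real p ^ i * q ^ i = 1" for i by (metis power_mult_distrib power_one)
  have "real (varrho (p ^ a)) \<le> real (totient (p ^ a)) + 1"
    using varrho_prime_power_le[OF assms] by linarith
  also have "\<dots> = real p ^ b * (real p - 1) + 1"
    using assms(1) p by (simp add: totient_prime_power_Suc a of_nat_diff del: power_Suc)
  also have "\<dots> = real p ^ a * (1 - q + q ^ a)"
    using pq'[of a] pq by (simp add: a algebra_simps)
  finally have 1: "real (varrho (p ^ a)) \<le> real p ^ a * (1 - q + q ^ a)" .
  have "real (divisor_sum (p ^ a)) = (\<Sum>i\<le>a. real p ^ (a - i))"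
    unfolding divisor_sum_prime_power[OF assms(1)] of_nat_sum of_nat_power
    by (rule sum.reindex_bij_witness[of _ "\<lambda>i. a - i" "\<lambda>i. a - i"]) auto
  also have "\<dots> = (\<Sum>i\<le>a. real p ^ a * q ^ i)"
  proof (rule sum.cong)
    fix i assume "i \<in> {..a}"
    hence "real p ^ a = real p ^ (a - i) * real p ^ i" by (simp add: power_add[symmetric])
    thus "real p ^ (a - i) = real p ^ a * q ^ i" using pq'[of i] by simp
  qed auto
  finally have 2: "real (divisor_sum (p ^ a)) = real p ^ a * (\<Sum>i\<le>a. q ^ i)"
    by (simp add: sum_distrib_left)
  have "real (varrho (p ^ a)) * real (divisor_sum (p ^ a))
          \<le> real p ^ a * (1 - q + q ^ a) * (real p ^ a * (\<Sum>i\<le>a. q ^ i))"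
    unfolding 2 by (intro mult_right_mono 1 mult_nonneg_nonneg sum_nonneg) (use q in auto)
  also have "\<dots> = real (p ^ a) ^ 2 * ((1 - q + q ^ a) * (\<Sum>i\<le>a. q ^ i))"
    by (simp add: power2_eq_square algebra_simps)
  also have "\<dots> \<le> real (p ^ a) ^ 2 * (1 + q)"
    by (intro mult_left_mono local_factor_le q assms) auto
  finally show ?thesis by (simp add: q_def)
qed

text \<open>The induction step for passing from prime powers to all \<open>n\<close>: a full prime
  power is split off, so that the cofactor is both smaller and coprime to it.\<close>

lemma prime_power_cofactor:
  fixes n :: nat
  assumes "n > 1"
  obtains p a m where "prime p" "a > 0" "\<not> p dvd m" "m > 0" "m < n" "n = p ^ a * m"
    "coprime (p ^ a) m" "prime_factors n = insert p (prime_factors m)" "p \<notin> prime_factors m"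
proof -
  obtain p where p: "prime p" "p dvd n" using assms prime_factor_nat by (metis less_not_refl)
  obtain m where m: "n = p ^ multiplicity p n * m" "\<not> p dvd m"
    using assms p(1) by (metis multiplicity_decompose' not_prime_unit not_one_less_zero)
  define a where "a = multiplicity p n"
  have a: "a > 0" using p assms unfolding a_def by (simp add: prime_multiplicity_gt_zero_iff)
  have m0: "m > 0" using m assms by (auto intro!: Nat.gr0I)
  have "p ^ a > 1" using p(1) a by (intro one_less_power prime_gt_1_nat)
  hence "1 * m < p ^ a * m" using m0 by (intro mult_strict_right_mono)
  hence "m < n" using m(1) by (simp add: a_def)
  moreover have "coprime (p ^ a) m" using p(1) m(2) by (simp add: prime_imp_coprime_nat)
  moreover have "prime_factors n = insert p (prime_factors m)"
    using p(1) m(1) a m0 unfolding a_def[symmetric]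
    by (simp add: prime_factors_product prime_factorization_prime prime_factors_power)
  moreover have "p \<notin> prime_factors m" using m(2) by auto
  ultimately show ?thesis using that p(1) a m m0 unfolding a_def by blast
qed

lemma varrho_divisor_sum_le:
  assumes "n > 0"
  shows "real (varrho n) * real (divisor_sum n) \<le> real n ^ 2 * (\<Prod>p\<in>prime_factors n. 1 + 1 / real p)"
  using assms
proof (induction n rule: less_induct)
  case (less n)
  show ?case
  proof (cases "n = 1")
    case True
    have "varrho 1 \<le> 1" by (rule varrho_le)
    thus ?thesis using True by (simp add: divisor_sum_def)
  next
    case False
    hence "n > 1" using less.prems by simp
    then obtain p a m where pam: "prime p" "a > 0" "\<not> p dvd m" "m > 0" "m < n" "n = p ^ a * m"
      "coprime (p ^ a) m" "prime_factors n = insert p (prime_factors m)" "p \<notin> prime_factors m"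
      by (rule prime_power_cofactor)
    have pa: "p ^ a > 0" using pam(1) by (simp add: prime_gt_0_nat)
    have "real (varrho n) * real (divisor_sum n)
      \<le> (real (varrho (p ^ a)) * real (varrho m)) * (real (divisor_sum (p ^ a)) * real (divisor_sum m))"
      unfolding pam(6) of_nat_mult[symmetric] of_nat_le_iff divisor_sum_mult[OF pam(7) pa pam(4)]
      by (intro mult_right_mono varrho_mult_le pam pa) auto
    also have "\<dots> = (real (varrho (p ^ a)) * real (divisor_sum (p ^ a))) * (real (varrho m) * real (divisor_sum m))"
      by (simp add: mult_ac)
    also have "\<dots> \<le> (real (p ^ a) ^ 2 * (1 + 1 / real p)) * (real m ^ 2 * (\<Prod>p\<in>prime_factors m. 1 + 1 / real p))"
      by (intro mult_mono varrho_divisor_sum_prime_power_le less.IH pam) auto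
    also have "\<dots> = real n ^ 2 * (\<Prod>p\<in>prime_factors n. 1 + 1 / real p)"
      using pam(9) by (simp add: pam(8)) (simp add: pam(6) power_mult_distrib)
    finally show ?thesis .
  qed
qed

section \<open>Products of distinct primes, where equality is attained\<close>

lemma divisor_sum_prod_primes:
  assumes "finite P" "\<And>p. p \<in> P \<Longrightarrow> prime p"
  shows "real (divisor_sum (\<Prod>P)) = real (\<Prod>P) * (\<Prod>p\<in>P. 1 + 1 / real p)"
  using assms
proof (induction P rule: finite_induct)
  case (insert p P)
  have p: "prime p" using insert by auto
  have "coprime p (\<Prod>P)"
    using insert p by (intro prod_coprime_right) (metis insert_iff primes_coprime)
  moreover have "\<Prod>P > 0" using insert by (intro prod_pos) (auto simp: prime_gt_0_nat)
  moreover have "divisor_sum p = p + 1"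
    using divisor_sum_prime_power[OF p, of 1] by simp
  ultimately have "real (divisor_sum (\<Prod>(insert p P))) = (real p + 1) * real (divisor_sum (\<Prod>P))"
    using insert p by (simp add: divisor_sum_mult prime_gt_0_nat algebra_simps)
  also have "\<dots> = real (\<Prod>(insert p P)) * (\<Prod>p\<in>insert p P. 1 + 1 / real p)"
    using insert prime_gt_0_nat[OF p] by (simp add: distrib_left distrib_right mult_ac)
  finally show ?case .
qed (simp add: divisor_sum_def)

lemma squarefree_prod_primes:
  assumes "finite P" "\<And>p. p \<in> P \<Longrightarrow> prime (p::nat)"
  shows "squarefree (\<Prod>P)"
  using assms by (intro squarefree_prod_coprime) (auto intro: squarefree_prime primes_coprime)

lemma prime_factors_prod_primes:
  assumes "finite P" "\<And>p. p \<in> P \<Longrightarrow> prime (p::nat)"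
  shows "prime_factors (\<Prod>P) = P"
  using assms by (subst prime_factors_prod) (auto simp: prime_prime_factors dest: prime_gt_0_nat)

section \<open>The zeta function and the primes\<close>

text \<open>The Riemann zeta function on the real half-line \<open>s > 1\<close>. The index may
  start at 0 because \<open>0 powr -s = 0\<close>.\<close>

definition real_zeta :: "real \<Rightarrow> real" where
  "real_zeta s = (\<Sum>n. real n powr -s)"

lemma real_zeta_sums:
  assumes "s > 1"
  shows "(\<lambda>n. real n powr -s) sums real_zeta s"
  unfolding real_zeta_def using assms by (intro summable_sums) (simp add: summable_real_powr_iff)

text \<open>Unconditional summation allows the reindexing and set differences of the sieve.\<close>

lemma real_zeta_has_sum:
  assumes "s > 1"
  shows "((\<lambda>n. real n powr -s) has_sum real_zeta s) {0<..}"
proof -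
  have "((\<lambda>n. real n powr -s) has_sum real_zeta s) UNIV"
    by (intro sums_nonneg_imp_has_sum real_zeta_sums assms) auto
  thus ?thesis
    by (rule has_sum_cong_neutral[THEN iffD1, rotated -1]) auto
qed

text \<open>Sieving out one prime at a time proves the Euler product without unique factorisation.\<close>

lemma has_sum_sieve:
  assumes "s > 1" "finite P" "\<And>p. p \<in> P \<Longrightarrow> prime p"
  shows "((\<lambda>n. real n powr -s) has_sum (\<Prod>p\<in>P. 1 - real p powr -s) * real_zeta s)
           {n. n > 0 \<and> (\<forall>p\<in>P. \<not> p dvd n)}"
  using assms(2,3)
proof (induction P rule: finite_induct)
  case empty
  thus ?case using real_zeta_has_sum[OF assms(1)] by (simp add: greaterThan_def)
next
  case (insert p P)
  let ?f = "\<lambda>n. real n powr -s"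
  let ?A = "\<lambda>P. {n. n > 0 \<and> (\<forall>p\<in>P. \<not> p dvd n)}"
  let ?S = "(\<Prod>p\<in>P. 1 - real p powr -s) * real_zeta s"
  have p: "prime p" "p > 0" using insert by (auto simp: prime_gt_0_nat)
  have IH: "(?f has_sum ?S) (?A P)" using insert by auto
  \<comment> \<open>The survivors divisible by \<open>p\<close> are \<open>p\<close> times the
    survivors and carry the fraction \<open>real p powr -s\<close> of the sum; removing them
    produces the new Euler factor.\<close>
  hence "((\<lambda>n. real p powr -s * ?f n) has_sum (real p powr -s * ?S)) (?A P)"
    by (rule has_sum_cmult_right)
  hence "((?f \<circ> (\<lambda>n. p * n)) has_sum (real p powr -s * ?S)) (?A P)"
    by (rule has_sum_cong[THEN iffD1, rotated]) (simp add: powr_mult)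
  hence "(?f has_sum (real p powr -s * ?S)) ((\<lambda>n. p * n) ` ?A P)"
    using p by (subst has_sum_reindex) (auto simp: inj_on_def)
  moreover have "(\<lambda>n. p * n) ` ?A P \<subseteq> ?A P"
  proof (clarsimp simp: p(2))
    fix q n assume "q \<in> P" "q dvd p * n" "\<forall>q\<in>P. \<not> q dvd n"
    moreover have "prime q" "q \<noteq> p" using \<open>q \<in> P\<close> insert by auto
    ultimately show False using p(1) by (metis prime_dvd_mult_iff primes_dvd_imp_eq)
  qed
  ultimately have "(?f has_sum (?S - real p powr -s * ?S)) (?A P - (\<lambda>n. p * n) ` ?A P)"
    by (intro has_sum_Diff IH)
  moreover have "?A P - (\<lambda>n. p * n) ` ?A P = ?A (insert p P)"
  proof (intro equalityI subsetI)
    fix n assume n: "n \<in> ?A P - (\<lambda>n. p * n) ` ?A P"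
    have "\<not> p dvd n"
    proof
      assume "p dvd n"
      then obtain k where "n = p * k" by auto
      moreover from this have "k \<in> ?A P" using n by auto
      ultimately show False using n by blast
    qed
    thus "n \<in> ?A (insert p P)" using n by auto
  qed auto
  moreover have "?S - real p powr -s * ?S = (\<Prod>p\<in>insert p P. 1 - real p powr -s) * real_zeta s"
    using insert by (simp add: algebra_simps)
  ultimately show ?case by simp
qed

lemma prime_one_minus_powr_pos:
  assumes "prime p" "s > 0"
  shows "0 < 1 - real p powr -s"
  using assms prime_gt_1_nat[of p] by (simp add: powr_less_one)

lemma real_zeta_pos:
  assumes "s > 1"
  shows "real_zeta s > 0"
  unfolding real_zeta_def
  by (rule suminf_pos2[where i = 1]) (use assms in \<open>auto simp: summable_real_powr_iff\<close>)

text \<open>Apart from 1, every number surviving the primes up to \<open>N\<close> exceeds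
  \<open>N\<close>. The sieved sum therefore lies between 1 and 1 plus a tail of the zeta
  series.\<close>

lemma euler_product_LIMSEQ:
  assumes "s > 1"
  shows "(\<lambda>N. \<Prod>p | prime p \<and> p \<le> N. 1 - real p powr -s) \<longlonglongrightarrow> 1 / real_zeta s"
proof -
  let ?f = "\<lambda>n::nat. real n powr -s"
  let ?P = "\<lambda>N::nat. {p. prime p \<and> p \<le> N}"
  let ?A = "\<lambda>N::nat. {n. n > 0 \<and> (\<forall>p\<in>?P N. \<not> p dvd n)}"
  let ?S = "\<lambda>N. (\<Prod>p\<in>?P N. 1 - real p powr -s) * real_zeta s"
  have sieve: "(?f has_sum ?S N) (?A N)" for N
    by (rule has_sum_sieve[OF assms]) auto
  have one: "(?f has_sum 1) {1}" by (rule has_sum_finiteI) auto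
  have lower: "1 \<le> ?S N" for N
    by (rule has_sum_mono2[OF one sieve]) auto
  have upper: "?S N \<le> 1 + (real_zeta s - sum ?f {..N})" if "N \<ge> 1" for N
  proof (rule has_sum_mono2[OF sieve])
    have "(?f has_sum (real_zeta s - sum ?f {0<..N})) ({0<..} - {0<..N})"
      by (intro has_sum_Diff real_zeta_has_sum assms has_sum_finite) auto
    also have "sum ?f {0<..N} = sum ?f {..N}"
      by (rule sum.mono_neutral_left) auto
    also have "{0<..} - {0<..N} = {N<..}" by auto
    finally show "(?f has_sum (1 + (real_zeta s - sum ?f {..N}))) ({1} \<union> {N<..})"
      using that by (intro has_sum_Un_disjoint one) auto
    show "?A N \<subseteq> {1} \<union> {N<..}"
    proof
      fix n assume n: "n \<in> ?A N"
      show "n \<in> {1} \<union> {N<..}"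
      proof (cases "n = 1")
        case False
        then obtain p where "prime p" "p dvd n" using prime_factor_nat by blast
        moreover from this have "p \<le> n" using n by (auto intro: dvd_imp_le)
        ultimately show ?thesis using n by force
      qed auto
    qed
  qed auto
  have "(\<lambda>N. sum ?f {..N}) \<longlonglongrightarrow> real_zeta s"
    using real_zeta_sums[OF assms] by (simp add: sums_def_le)
  hence "(\<lambda>N. 1 + (real_zeta s - sum ?f {..N})) \<longlonglongrightarrow> 1 + (real_zeta s - real_zeta s)"
    by (intro tendsto_intros)
  hence "(\<lambda>N. 1 + (real_zeta s - sum ?f {..N})) \<longlonglongrightarrow> 1" by simp
  have "?S \<longlonglongrightarrow> 1"
  proof (rule tendsto_sandwich)
    show "eventually (\<lambda>N. 1 \<le> ?S N) sequentially"
      using lower by simp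
    show "eventually (\<lambda>N. ?S N \<le> 1 + (real_zeta s - sum ?f {..N})) sequentially"
      using upper by (intro eventually_sequentiallyI)
    show "(\<lambda>N. 1 + (real_zeta s - sum ?f {..N})) \<longlonglongrightarrow> 1" by fact
  qed auto
  hence "(\<lambda>N. ?S N / real_zeta s) \<longlonglongrightarrow> 1 / real_zeta s"
    using real_zeta_pos[OF assms] by (intro tendsto_divide tendsto_const) auto
  thus ?thesis using real_zeta_pos[OF assms] by simp
qed

lemma sums_ln_real_zeta:
  assumes "s > 1"
  shows "(\<lambda>n. if prime n then - ln (1 - real n powr -s) else 0) sums ln (real_zeta s)"
proof -
  have "(\<lambda>N. - ln (\<Prod>p | prime p \<and> p \<le> N. 1 - real p powr -s)) \<longlonglongrightarrow> - ln (1 / real_zeta s)"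
    using real_zeta_pos[OF assms] by (intro tendsto_intros euler_product_LIMSEQ assms) auto
  moreover have "- ln (\<Prod>p | prime p \<and> p \<le> N. 1 - real p powr -s)
      = (\<Sum>n\<le>N. if prime n then - ln (1 - real n powr -s) else 0)" for N
  proof -
    have "ln (\<Prod>p | prime p \<and> p \<le> N. 1 - real p powr -s) = (\<Sum>p | prime p \<and> p \<le> N. ln (1 - real p powr -s))"
      using assms by (intro ln_prod) (auto dest!: prime_one_minus_powr_pos[of _ s])
    also have "- \<dots> = (\<Sum>p | prime p \<and> p \<le> N. - ln (1 - real p powr -s))"
      by (simp add: sum_negf)
    also have "\<dots> = (\<Sum>n\<le>N. if prime n then - ln (1 - real n powr -s) else 0)"
      by (subst sum.inter_filter[symmetric]) (auto intro!: sum.cong)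
    finally show ?thesis .
  qed
  ultimately show ?thesis
    using real_zeta_pos[OF assms] by (simp add: sums_def_le ln_div)
qed

text \<open>The integral test without an integral: by the mean value theorem the difference equals
  \<open>z powr -s\<close> for some \<open>z\<close> strictly between \<open>x\<close> and
  \<open>x + 1\<close>, and this power decreases in \<open>z\<close>.\<close>

lemma powr_telescope_bounds:
  fixes x s :: real
  assumes "x > 0" "s > 1"
  shows "(x + 1) powr -s \<le> x powr (1 - s) / (s - 1) - (x + 1) powr (1 - s) / (s - 1)"
    and "x powr (1 - s) / (s - 1) - (x + 1) powr (1 - s) / (s - 1) \<le> x powr -s"
proof -
  have scale: "(1 - s) * w / (s - 1) = - w" for w
    using assms by (simp add: field_simps)
  have "\<exists>z>x. z < x + 1 \<and> (x + 1) powr (1 - s) / (s - 1) - x powr (1 - s) / (s - 1) = (x + 1 - x) * - (z powr -s)"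
  proof (rule MVT2)
    fix y assume "x \<le> y"
    hence "((\<lambda>y. y powr (1 - s)) has_real_derivative (1 - s) * y powr (1 - s - 1)) (at y)"
      using assms by (intro has_real_derivative_powr) auto
    from DERIV_cdivide[OF this, of "s - 1"]
    show "((\<lambda>y. y powr (1 - s) / (s - 1)) has_real_derivative - (y powr -s)) (at y)"
      using scale by simp
  qed simp
  then obtain z where z: "x < z" "z < x + 1"
    "x powr (1 - s) / (s - 1) - (x + 1) powr (1 - s) / (s - 1) = z powr -s" by auto
  show "(x + 1) powr -s \<le> x powr (1 - s) / (s - 1) - (x + 1) powr (1 - s) / (s - 1)"
    unfolding z(3) using z assms by (intro powr_mono2') auto
  show "x powr (1 - s) / (s - 1) - (x + 1) powr (1 - s) / (s - 1) \<le> x powr -s"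
    unfolding z(3) using z assms by (intro powr_mono2') auto
qed

text \<open>The telescoping series starting at 1 has sum \<open>1 / (s - 1)\<close>. It is dominated
  by the zeta series and dominates that series with its term 1 dropped.\<close>

lemma real_zeta_bounds:
  assumes "s > 1"
  shows "1 / (s - 1) \<le> real_zeta s" "real_zeta s \<le> 1 + 1 / (s - 1)"
proof -
  let ?g = "\<lambda>n. real (Suc n) powr (1 - s) / (s - 1)"
  have "?g \<longlonglongrightarrow> 0" using assms by real_asymp
  hence tele: "(\<lambda>n. ?g n - ?g (Suc n)) sums (1 / (s - 1))"
    using telescope_sums'[of ?g 0] by simp
  have 1: "(\<lambda>n. real (Suc n) powr -s) sums real_zeta s"
    using real_zeta_sums[OF assms] by (subst sums_Suc_iff) auto
  have 2: "(\<lambda>n. real (Suc (Suc n)) powr -s) sums (real_zeta s - 1)"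
    using 1 by (subst sums_Suc_iff) auto
  show "1 / (s - 1) \<le> real_zeta s"
    using powr_telescope_bounds(2)[of "real (Suc _)" s] assms
    by (intro sums_le[OF _ tele 1]) (auto simp: add_ac)
  have "real_zeta s - 1 \<le> 1 / (s - 1)"
    using powr_telescope_bounds(1)[of "real (Suc _)" s] assms
    by (intro sums_le[OF _ 2 tele]) (auto simp: add_ac)
  thus "real_zeta s \<le> 1 + 1 / (s - 1)" by simp
qed

text \<open>The bounds \<open>1 / d\<close> and \<open>(1 + d) / d\<close> for
  \<open>real_zeta (1 + d)\<close> squeeze the expression between 0 and
  \<open>ln (1 + d)\<close>.\<close>

lemma ln_real_zeta_asymp: "((\<lambda>d. ln (real_zeta (1 + d)) + ln d) \<longlongrightarrow> 0) (at_right 0)"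
proof (rule tendsto_sandwich)
  show "eventually (\<lambda>d. 0 \<le> ln (real_zeta (1 + d)) + ln d) (at_right 0)"
    using eventually_at_right_less[of 0]
  proof eventually_elim
    case (elim d)
    have "ln (1 / d) \<le> ln (real_zeta (1 + d))"
      using real_zeta_bounds(1)[of "1 + d"] elim by (intro ln_mono) auto
    thus ?case using elim by (simp add: ln_div)
  qed
  show "eventually (\<lambda>d. ln (real_zeta (1 + d)) + ln d \<le> ln (1 + d)) (at_right 0)"
    using eventually_at_right_less[of 0]
  proof eventually_elim
    case (elim d)
    have "ln (real_zeta (1 + d)) \<le> ln (1 + 1 / d)"
      using real_zeta_bounds(2)[of "1 + d"] real_zeta_pos[of "1 + d"] elim by (intro ln_mono) auto
    also have "1 + 1 / d = (1 + d) / d" using elim by (simp add: field_simps)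
    finally show ?case using elim by (simp add: ln_div)
  qed
  show "((\<lambda>d::real. ln (1 + d)) \<longlongrightarrow> 0) (at_right 0)" by real_asymp
qed auto

section \<open>The measure on the primes and its Laplace transform\<close>

text \<open>Exponentiating the partial sums gives the product of \<open>1 / (1 - 1 / p)\<close>, so
  Mertens' third theorem becomes a statement about these masses.\<close>

definition prime_weight :: "nat \<Rightarrow> real" where
  "prime_weight n = (if prime n then - ln (1 - 1 / real n) else 0)"

lemma prime_weight_bounds:
  "0 \<le> prime_weight n" "prime_weight n \<le> 2 / real n"
proof -
  have *: "- ln (1 - 1 / real n) \<le> 2 * (1 / real n)" "0 \<le> - ln (1 - 1 / real n)" if "prime n"
  proof -
    have n: "real n \<ge> 2" using prime_ge_2_nat[OF that] by simp
    show "0 \<le> - ln (1 - 1 / real n)" using n by simp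
    have "ln (real n / (real n - 1)) \<le> real n / (real n - 1) - 1"
      using n by (intro ln_le_minus_one) auto
    also have "\<dots> \<le> 2 / real n" using n by (simp add: field_simps)
    also have "real n / (real n - 1) = 1 / (1 - 1 / real n)" using n by (simp add: field_simps)
    finally show "- ln (1 - 1 / real n) \<le> 2 * (1 / real n)" using n by (simp add: ln_div)
  qed
  show "0 \<le> prime_weight n" "prime_weight n \<le> 2 / real n"
    using * by (auto simp: prime_weight_def)
qed

lemma summable_prime_weight:
  assumes "d > 0"
  shows "summable (\<lambda>n. prime_weight n * exp (- d * ln (real n)))"
proof (rule summable_comparison_test)
  show "summable (\<lambda>n. 2 * real n powr (- 1 - d))"
    using assms by (intro summable_mult) (simp add: summable_real_powr_iff)
  have "norm (prime_weight n * exp (- d * ln (real n))) \<le> 2 * real n powr (- 1 - d)" for n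
  proof (cases "n = 0")
    case False
    have "norm (prime_weight n * exp (- d * ln (real n))) \<le> 2 / real n * exp (- d * ln (real n))"
      using prime_weight_bounds[of n] unfolding norm_mult by (intro mult_mono) auto
    also have "\<dots> = 2 * real n powr (- 1 - d)"
      using False by (simp add: powr_diff powr_minus_divide powr_def[of _ d] exp_minus field_simps)
    finally show ?thesis .
  qed (simp add: prime_weight_def)
  thus "\<exists>N. \<forall>n\<ge>N. norm (prime_weight n * exp (- d * ln (real n))) \<le> 2 * real n powr (- 1 - d)"
    by blast
qed

text \<open>Both terms equal \<open>- q * t\<close> up to an error quadratic in \<open>q\<close>.
  With \<open>q = 1 / p\<close> and \<open>t = exp (- d * ln p)\<close> this compares the Euler
  factor at \<open>1 + d\<close> with the damped weight of \<open>p\<close>, at a summable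
  cost.\<close>

lemma ln_one_minus_scale_bound:
  fixes q t :: real
  assumes "0 \<le> q" "q \<le> 1 / 2" "0 \<le> t" "t \<le> 1"
  shows "\<bar>ln (1 - q * t) - t * ln (1 - q)\<bar> \<le> 2 * q\<^sup>2"
proof -
  have qt: "0 \<le> q * t" "q * t \<le> q" using assms by (auto simp: mult_left_le)
  have t2: "t\<^sup>2 \<le> 1" using assms by (simp add: power_le_one)
  have "- q - 2 * q\<^sup>2 \<le> ln (1 - q)" "- (q * t) - 2 * (q * t)\<^sup>2 \<le> ln (1 - q * t)"
    using assms qt by (auto intro!: ln_one_minus_pos_lower_bound)
  moreover have "ln (1 - q) \<le> - q" "ln (1 - q * t) \<le> - (q * t)"
    using assms qt ln_le_minus_one[of "1 - q"] ln_le_minus_one[of "1 - q * t"] by auto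
  moreover have "t * (- q - 2 * q\<^sup>2) \<le> t * ln (1 - q)" "t * ln (1 - q) \<le> t * (- q)"
    using calculation assms by (blast intro: mult_left_mono)+
  moreover have "t * q\<^sup>2 \<le> q\<^sup>2" "(q * t)\<^sup>2 \<le> q\<^sup>2"
    using assms t2 by (auto simp: mult_left_le_one_le power_mult_distrib mult_left_le)
  ultimately show ?thesis by (simp add: algebra_simps abs_le_iff)
qed

text \<open>The transform differs from \<open>ln (real_zeta (1 + d))\<close> by the series of the
  terms \<open>a n d\<close>. Each term tends to 0 and is dominated by \<open>2 / n^2\<close>
  uniformly in \<open>d > 0\<close>, so Tannery's theorem lets the whole difference vanish.\<close>

lemma prime_weight_laplace:
  "((\<lambda>d. (\<Sum>n. prime_weight n * exp (- d * ln (real n))) + ln d) \<longlongrightarrow> 0) (at_right 0)"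
proof -
  define a where "a = (\<lambda>n d. if prime n then ln (1 - real n powr (- 1 - d))
                              - exp (- d * ln (real n)) * ln (1 - 1 / real n) else 0)"
  have "((\<lambda>d. suminf (\<lambda>n. a n d)) \<longlongrightarrow> suminf (\<lambda>n. 0)) (at_right 0)"
  proof (rule tannerys_theorem[THEN conjunct2, THEN conjunct2])
    fix n
    have "((\<lambda>d. ln (1 - real n powr (- 1 - d)) - exp (- d * ln (real n)) * ln (1 - 1 / real n))
       \<longlongrightarrow> ln (1 - real n powr (- 1 - 0)) - exp (- 0 * ln (real n)) * ln (1 - 1 / real n)) (at_right 0)"
      if "prime n"
      using that prime_one_minus_powr_pos[of n 1] by (intro tendsto_intros) auto
    thus "((\<lambda>d. a n d) \<longlongrightarrow> 0) (at_right 0)"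
      by (cases "prime n") (auto simp: a_def powr_minus_divide prime_gt_0_nat)
  next
    have "\<bar>a n d\<bar> \<le> 2 * inverse (real n ^ 2)" if "d > 0" for n d
    proof (cases "prime n")
      case True
      have n: "real n \<ge> 2" using prime_ge_2_nat[OF True] by simp
      have "real n powr (- 1 - d) = 1 / real n * exp (- d * ln (real n))"
        using n by (simp add: powr_diff powr_minus_divide powr_def[of _ d] exp_minus field_simps)
      hence "a n d = ln (1 - 1 / real n * exp (- d * ln (real n))) - exp (- d * ln (real n)) * ln (1 - 1 / real n)"
        using True by (simp add: a_def)
      also have "\<bar>\<dots>\<bar> \<le> 2 * (1 / real n)\<^sup>2"
        using n that by (intro ln_one_minus_scale_bound) (auto simp: field_simps)
      finally show ?thesis by (simp add: power_divide divide_simps)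
    qed (simp add: a_def)
    thus "eventually (\<lambda>(n, d). norm (a n d) \<le> 2 * inverse (real n ^ 2)) (at_top \<times>\<^sub>F at_right 0)"
      by (subst eventually_prod_filter, intro exI[of _ "\<lambda>_. True"] exI[of _ "\<lambda>d. d > 0"])
         (auto simp: eventually_at_right_less)
    show "summable (\<lambda>n. 2 * inverse (real n ^ 2))"
      by (intro summable_mult inverse_power_summable) auto
  qed auto
  hence "((\<lambda>d. suminf (\<lambda>n. a n d) + (ln (real_zeta (1 + d)) + ln d)) \<longlongrightarrow> 0 + 0) (at_right 0)"
    by (intro tendsto_add ln_real_zeta_asymp) auto
  moreover have "eventually (\<lambda>d. suminf (\<lambda>n. a n d) + (ln (real_zeta (1 + d)) + ln d)
      = (\<Sum>n. prime_weight n * exp (- d * ln (real n))) + ln d) (at_right 0)"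
    using eventually_at_right_less[of 0]
  proof eventually_elim
    case (elim d)
    have "a n d = prime_weight n * exp (- d * ln (real n)) - (if prime n then - ln (1 - real n powr -(1 + d)) else 0)" for n
      by (simp add: a_def prime_weight_def algebra_simps)
    hence "(\<lambda>n. a n d) sums ((\<Sum>n. prime_weight n * exp (- d * ln (real n))) - ln (real_zeta (1 + d)))"
      using sums_diff[OF summable_sums[OF summable_prime_weight[OF elim]] sums_ln_real_zeta[of "1 + d"]] elim
      by simp
    thus ?case by (simp add: sums_iff)
  qed
  ultimately show ?thesis by (simp add: tendsto_cong)
qed

lemma real_zeta_2: "real_zeta 2 = pi\<^sup>2 / 6"
proof -
  have "(\<lambda>n. real (Suc n) powr -2) sums (pi\<^sup>2 / 6)"
    using inverse_squares_sums by (simp add: powr_minus_divide powr_numeral add_ac)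
  hence "(\<lambda>n. real n powr -2) sums (pi\<^sup>2 / 6)"
    by (subst (asm) sums_Suc_iff) auto
  thus ?thesis using real_zeta_sums[of 2] sums_unique2 by fastforce
qed

section \<open>A Tauberian theorem\<close>

text \<open>The error $e (v - v^2)$ vanishes at both end points, so that it stays bounded when summed
  against a measure whose total mass diverges logarithmically; this is achieved by approximating
  $(\mathit{step}(v) - v) / (v - v^2)$ instead of the step function itself.\<close>

lemma polynomial_step_approx:
  fixes a b e :: real
  assumes "0 < b" "b < a" "a < 1" "e > 0"
  obtains c m where
    "\<And>v. v \<in> {0..1} \<Longrightarrow> of_bool (a \<le> v) \<le> v + (\<Sum>i\<le>m. c i * (v ^ Suc i - v ^ Suc (Suc i))) + e * (v - v ^ 2)"
    "\<And>v. v \<in> {0..1} \<Longrightarrow> v + (\<Sum>i\<le>m. c i * (v ^ Suc i - v ^ Suc (Suc i))) \<le> of_bool (b \<le> v) + e * (v - v ^ 2)"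
proof -
  \<comment> \<open>A continuous ramp from 0 at \<open>b\<close> to 1 at \<open>a\<close>, lying
    between the two step functions.\<close>
  define \<phi> where "\<phi> = (\<lambda>v::real. max 0 (min 1 ((v - b) / (a - b))))"
  \<comment> \<open>Partial fractions of \<open>(\<phi> v - v) / (v - v^2)\<close>. The truncations
    act only where the numerators vanish, and they keep the denominators at least \<open>b\<close>
    and \<open>1 - a\<close>, so the quotient extends continuously to the end points.\<close>
  define \<rho> where "\<rho> = (\<lambda>v. \<phi> v / max v b - (1 - \<phi> v) / (1 - min v a))"
  have \<phi>: "0 \<le> \<phi> v" "\<phi> v \<le> 1" "v \<le> b \<Longrightarrow> \<phi> v = 0" "a \<le> v \<Longrightarrow> \<phi> v = 1" for v
    using assms by (auto simp: \<phi>_def max_def min_def field_simps)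
  have \<rho>: "v + (v - v ^ 2) * \<rho> v = \<phi> v" if "v \<in> {0..1}" for v
  proof -
    consider "v \<le> b" | "b < v" "v < a" | "a \<le> v" by linarith
    thus ?thesis
    proof cases
      case 1
      thus ?thesis using assms by (simp add: \<rho>_def \<phi> field_simps power2_eq_square)
    next
      case 2
      hence "v > 0" "v < 1" using assms by auto
      thus ?thesis using 2 assms by (simp add: \<rho>_def field_simps power2_eq_square)
    next
      case 3
      hence "v > 0" using assms by auto
      thus ?thesis using 3 assms by (simp add: \<rho>_def \<phi> field_simps power2_eq_square)
    qed
  qed
  have "continuous_on {0..1} \<rho>"
    unfolding \<rho>_def \<phi>_def using assms by (intro continuous_intros) auto
  then obtain g where g: "real_polynomial_function g" "\<And>v. v \<in> {0..1} \<Longrightarrow> \<bar>\<rho> v - g v\<bar> < e"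
    using Stone_Weierstrass_real_polynomial_function[of "{0..1}" \<rho> e] assms by auto
  then obtain c m where c: "g = (\<lambda>v. \<Sum>i\<le>m. c i * v ^ i)"
    by (auto simp: real_polynomial_function_iff_sum)
  have *: "\<bar>v + (\<Sum>i\<le>m. c i * (v ^ Suc i - v ^ Suc (Suc i))) - \<phi> v\<bar> \<le> e * (v - v ^ 2)" if "v \<in> {0..1}" for v
  proof -
    have v: "0 \<le> v - v ^ 2" using that by (auto simp: power2_eq_square mult_left_le)
    have "v + (\<Sum>i\<le>m. c i * (v ^ Suc i - v ^ Suc (Suc i))) - \<phi> v = (v - v ^ 2) * (g v - \<rho> v)"
      unfolding \<rho>[OF that, symmetric] c right_diff_distrib sum_distrib_left
      by (simp add: power2_eq_square algebra_simps)
    also have "\<bar>\<dots>\<bar> \<le> (v - v ^ 2) * e"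
      unfolding abs_mult using v g(2)[OF that] by (intro mult_mono) auto
    finally show ?thesis by (simp add: mult.commute)
  qed
  show ?thesis
  proof (rule that)
    fix v :: real assume v: "v \<in> {0..1}"
    show "of_bool (a \<le> v) \<le> v + (\<Sum>i\<le>m. c i * (v ^ Suc i - v ^ Suc (Suc i))) + e * (v - v ^ 2)"
      using *[OF v] \<phi>[of v] by (cases "a \<le> v") auto
    show "v + (\<Sum>i\<le>m. c i * (v ^ Suc i - v ^ Suc (Suc i))) \<le> of_bool (b \<le> v) + e * (v - v ^ 2)"
      using *[OF v] \<phi>[of v] by (cases "b \<le> v") auto
  qed
qed

text \<open>In the variable \<open>v = exp (- d * u n)\<close> the monomial \<open>v ^ Suc k\<close>
  yields the Laplace transform at \<open>Suc k * d\<close>, while a step function yields a sharp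
  cutoff.\<close>

definition smoothed_sum :: "(nat \<Rightarrow> real) \<Rightarrow> (nat \<Rightarrow> real) \<Rightarrow> (real \<Rightarrow> real) \<Rightarrow> real \<Rightarrow> real" where
  "smoothed_sum x u g d = (\<Sum>n. x n * g (exp (- d * u n)))"

text \<open>The class of discrete measures, with masses \<open>x n\<close> at points
  \<open>u n\<close>, within which any two can be compared; the prime weights and the harmonic
  masses both belong to it.\<close>

definition log_laplace :: "(nat \<Rightarrow> real) \<Rightarrow> (nat \<Rightarrow> real) \<Rightarrow> bool" where
  "log_laplace x u \<longleftrightarrow> (\<forall>n. x n \<ge> 0) \<and> (\<forall>n. u n \<ge> 0) \<and>
     (\<forall>d>0. summable (\<lambda>n. x n * exp (- d * u n))) \<and>
     ((\<lambda>d. (\<Sum>n. x n * exp (- d * u n)) + ln d) \<longlongrightarrow> 0) (at_right 0)"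

lemma log_laplace_summable_power:
  assumes "log_laplace x u" "d > 0"
  shows "summable (\<lambda>n. x n * exp (- d * u n) ^ Suc k)"
proof -
  have "summable (\<lambda>n. x n * exp (- (real (Suc k) * d) * u n))"
    using assms unfolding log_laplace_def by (metis mult_pos_pos of_nat_0_less_iff zero_less_Suc)
  thus ?thesis by (simp only: exp_of_nat_mult[symmetric] mult_ac mult_minus_left mult_minus_right)
qed

text \<open>The sum is the transform at \<open>Suc k * d\<close>, and the constant comes from
  splitting \<open>ln (Suc k * d)\<close>.\<close>

lemma log_laplace_power:
  assumes "log_laplace x u"
  shows "((\<lambda>d. smoothed_sum x u (\<lambda>v. v ^ Suc k) d + ln d) \<longlongrightarrow> - ln (real (Suc k))) (at_right 0)"
proof -
  have "filterlim (\<lambda>d. real (Suc k) * d) (at_right 0) (at_right 0)"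
    by real_asymp
  hence "((\<lambda>d. (\<Sum>n. x n * exp (- (real (Suc k) * d) * u n)) + ln (real (Suc k) * d) - ln (real (Suc k)))
           \<longlongrightarrow> 0 - ln (real (Suc k))) (at_right 0)"
    using assms unfolding log_laplace_def
    by (intro tendsto_diff tendsto_const) (rule filterlim_compose[of _ _ _ "\<lambda>d. real (Suc k) * d"], auto)
  moreover have "eventually (\<lambda>d. (\<Sum>n. x n * exp (- (real (Suc k) * d) * u n)) + ln (real (Suc k) * d) - ln (real (Suc k))
      = smoothed_sum x u (\<lambda>v. v ^ Suc k) d + ln d) (at_right 0)"
    using eventually_at_right_less[of 0]
  proof eventually_elim
    case (elim d)
    have "smoothed_sum x u (\<lambda>v. v ^ Suc k) d = (\<Sum>n. x n * exp (- (real (Suc k) * d) * u n))"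
      unfolding smoothed_sum_def
      by (simp only: exp_of_nat_mult[symmetric] mult_ac mult_minus_left mult_minus_right)
    thus ?case using elim by (simp add: ln_mult)
  qed
  ultimately show ?thesis by (simp add: tendsto_cong)
qed

text \<open>The divergent \<open>ln d\<close> comes from the leading \<open>v\<close> alone, since
  it cancels in each difference of consecutive powers. What matters is that the limit depends only
  on the polynomial, not on the measure.\<close>

lemma log_laplace_polynomial:
  fixes c :: "nat \<Rightarrow> real" and m :: nat
  defines "g \<equiv> \<lambda>v. v + (\<Sum>i\<le>m. c i * (v ^ Suc i - v ^ Suc (Suc i)))"
  assumes "log_laplace x u"
  shows "d > 0 \<Longrightarrow> summable (\<lambda>n. x n * g (exp (- d * u n)))"
    and "((\<lambda>d. smoothed_sum x u g d + ln d)
           \<longlongrightarrow> (\<Sum>i\<le>m. c i * (ln (real (Suc (Suc i))) - ln (real (Suc i))))) (at_right 0)"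
proof -
  have expand: "x n * g v = x n * v ^ Suc 0 + (\<Sum>i\<le>m. c i * (x n * v ^ Suc i - x n * v ^ Suc (Suc i)))" for n v
    by (simp add: g_def algebra_simps sum_distrib_left sum_subtractf)
  have sums: "(\<lambda>n. x n * g (exp (- d * u n))) sums
          (smoothed_sum x u (\<lambda>v. v ^ Suc 0) d + (\<Sum>i\<le>m. c i *
             (smoothed_sum x u (\<lambda>v. v ^ Suc i) d - smoothed_sum x u (\<lambda>v. v ^ Suc (Suc i)) d)))" 
    if "d > 0" for d
    unfolding expand smoothed_sum_def
    by (intro sums_add sums_sum sums_mult sums_diff summable_sums log_laplace_summable_power assms that)
  show "summable (\<lambda>n. x n * g (exp (- d * u n)))" if "d > 0" for d
    using sums[OF that] by (rule sums_summable)
  have "((\<lambda>d. (smoothed_sum x u (\<lambda>v. v ^ Suc 0) d + ln d) + (\<Sum>i\<le>m. c i *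
             ((smoothed_sum x u (\<lambda>v. v ^ Suc i) d + ln d) - (smoothed_sum x u (\<lambda>v. v ^ Suc (Suc i)) d + ln d))))
     \<longlongrightarrow> - ln (real (Suc 0)) + (\<Sum>i\<le>m. c i * (- ln (real (Suc i)) - - ln (real (Suc (Suc i)))))) (at_right 0)"
    by (intro tendsto_add tendsto_sum tendsto_mult tendsto_diff tendsto_const log_laplace_power assms)
  moreover have "eventually (\<lambda>d. (smoothed_sum x u (\<lambda>v. v ^ Suc 0) d + ln d) + (\<Sum>i\<le>m. c i *
             ((smoothed_sum x u (\<lambda>v. v ^ Suc i) d + ln d) - (smoothed_sum x u (\<lambda>v. v ^ Suc (Suc i)) d + ln d)))
        = smoothed_sum x u g d + ln d) (at_right 0)"
    using eventually_at_right_less[of 0]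
  proof eventually_elim
    case (elim d)
    show ?case using sums_unique[OF sums[OF elim]] by (simp add: smoothed_sum_def[of _ _ g])
  qed
  ultimately have "((\<lambda>d. smoothed_sum x u g d + ln d)
     \<longlongrightarrow> - ln (real (Suc 0)) + (\<Sum>i\<le>m. c i * (- ln (real (Suc i)) - - ln (real (Suc (Suc i)))))) (at_right 0)"
    by (rule Lim_transform_eventually)
  thus "((\<lambda>d. smoothed_sum x u g d + ln d)
           \<longlongrightarrow> (\<Sum>i\<le>m. c i * (ln (real (Suc (Suc i))) - ln (real (Suc i))))) (at_right 0)"
    by simp
qed

text \<open>The two logarithmic divergences cancel, and the limit is
  \<open>ln 2 < 1\<close>.\<close>

lemma log_laplace_kernel:
  assumes "log_laplace x u"
  shows "d > 0 \<Longrightarrow> summable (\<lambda>n. x n * (exp (- d * u n) - exp (- d * u n) ^ 2))"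
    and "eventually (\<lambda>d. smoothed_sum x u (\<lambda>v. v - v ^ 2) d \<le> 1) (at_right 0)"
proof -
  have sums: "(\<lambda>n. x n * (exp (- d * u n) - exp (- d * u n) ^ 2)) sums
          (smoothed_sum x u (\<lambda>v. v ^ Suc 0) d - smoothed_sum x u (\<lambda>v. v ^ Suc 1) d)" if "d > 0" for d
    using sums_diff[OF summable_sums summable_sums, OF log_laplace_summable_power log_laplace_summable_power,
        OF assms that assms that, of 0 1]
    by (simp add: smoothed_sum_def algebra_simps power2_eq_square)
  show "summable (\<lambda>n. x n * (exp (- d * u n) - exp (- d * u n) ^ 2))" if "d > 0" for d
    using sums[OF that] by (rule sums_summable)
  have "((\<lambda>d. (smoothed_sum x u (\<lambda>v. v ^ Suc 0) d + ln d) - (smoothed_sum x u (\<lambda>v. v ^ Suc 1) d + ln d))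
    \<longlongrightarrow> - ln (real (Suc 0)) - - ln (real (Suc 1))) (at_right 0)"
    by (intro tendsto_diff log_laplace_power assms)
  moreover have "- ln (real (Suc 0)) - - ln (real (Suc 1)) < 1"
    using ln_2_less_1 by simp
  ultimately have "eventually (\<lambda>d. (smoothed_sum x u (\<lambda>v. v ^ Suc 0) d + ln d)
     - (smoothed_sum x u (\<lambda>v. v ^ Suc 1) d + ln d) < 1) (at_right 0)"
    by (rule order_tendstoD)
  thus "eventually (\<lambda>d. smoothed_sum x u (\<lambda>v. v - v ^ 2) d \<le> 1) (at_right 0)"
    using eventually_at_right_less[of 0]
  proof eventually_elim
    case (elim d)
    thus ?case using sums_unique[OF sums[of d]] by (simp add: smoothed_sum_def[of _ _ "\<lambda>v. v - v ^ 2"])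
  qed
qed

text \<open>The distribution function on the scale \<open>1 / d\<close>; in the variable
  \<open>v\<close> it is the step at \<open>exp (- \<alpha>)\<close>.\<close>

definition counting_sum :: "(nat \<Rightarrow> real) \<Rightarrow> (nat \<Rightarrow> real) \<Rightarrow> real \<Rightarrow> real \<Rightarrow> real" where
  "counting_sum x u \<alpha> d = (\<Sum>n. if d * u n \<le> \<alpha> then x n else 0)"

text \<open>Below the cutoff \<open>1 \<le> exp (\<alpha> - d * u n)\<close>, so the Laplace series
  dominates.\<close>

lemma log_laplace_summable_counting:
  assumes "log_laplace x u" "d > 0"
  shows "summable (\<lambda>n. if d * u n \<le> \<alpha> then x n else 0)"
proof (rule summable_comparison_test)
  show "summable (\<lambda>n. exp \<alpha> * (x n * exp (- d * u n)))"
    using assms by (intro summable_mult) (auto simp: log_laplace_def)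
  have "norm (if d * u n \<le> \<alpha> then x n else 0) \<le> exp \<alpha> * (x n * exp (- d * u n))" for n
  proof (cases "d * u n \<le> \<alpha>")
    case True
    have "x n * 1 \<le> x n * exp (\<alpha> - d * u n)"
      using assms True by (intro mult_left_mono) (auto simp: log_laplace_def)
    also have "exp (\<alpha> - d * u n) = exp \<alpha> * exp (- d * u n)"
      by (simp add: exp_add[symmetric])
    finally show ?thesis using True assms by (simp add: log_laplace_def mult_ac)
  qed (use assms in \<open>auto simp: log_laplace_def\<close>)
  thus "\<exists>N. \<forall>n\<ge>N. norm (if d * u n \<le> \<alpha> then x n else 0) \<le> exp \<alpha> * (x n * exp (- d * u n))"
    by blast
qed

text \<open>One polynomial is squeezed between the steps at \<open>exp (- \<alpha>)\<close> and
  \<open>exp (- \<beta>)\<close>; the gap between the cutoffs leaves room for it. Its smoothed sums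
  against the two measures have the same asymptotics.\<close>

lemma log_laplace_compare:
  assumes x: "log_laplace x u" and y: "log_laplace y w" and "0 < \<alpha>" "\<alpha> < \<beta>" "e > 0"
  shows "eventually (\<lambda>d. counting_sum x u \<alpha> d \<le> counting_sum y w \<beta> d + e) (at_right 0)"
proof -
  let ?a = "exp (- \<alpha>)" and ?b = "exp (- \<beta>)"
  \<comment> \<open>The error \<open>e\<close> is shared by the kernel of each measure and by the
    difference of the two smoothed sums.\<close>
  have "0 < ?b" "?b < ?a" "?a < 1" "e / 3 > 0" using assms by auto
  then obtain c m where c:
    "\<And>v. v \<in> {0..1} \<Longrightarrow> of_bool (?a \<le> v) \<le> v + (\<Sum>i\<le>m. c i * (v ^ Suc i - v ^ Suc (Suc i))) + e / 3 * (v - v ^ 2)"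
    "\<And>v. v \<in> {0..1} \<Longrightarrow> v + (\<Sum>i\<le>m. c i * (v ^ Suc i - v ^ Suc (Suc i))) \<le> of_bool (?b \<le> v) + e / 3 * (v - v ^ 2)"
    by (rule polynomial_step_approx) blast
  define g where "g = (\<lambda>v. v + (\<Sum>i\<le>m. c i * (v ^ Suc i - v ^ Suc (Suc i))))"
  have g_summable: "summable (\<lambda>n. z n * g (exp (- d * t n)))" if "log_laplace z t" "d > 0" for z t d
    using log_laplace_polynomial(1)[OF that] unfolding g_def .
  have lower: "counting_sum x u \<alpha> d \<le> smoothed_sum x u g d + e / 3 * smoothed_sum x u (\<lambda>v. v - v ^ 2) d" if d: "d > 0" for d
  proof -
    have "(\<lambda>n. x n * g (exp (- d * u n)) + e / 3 * (x n * (exp (- d * u n) - exp (- d * u n) ^ 2))) sums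
      (smoothed_sum x u g d + e / 3 * smoothed_sum x u (\<lambda>v. v - v ^ 2) d)"
      unfolding smoothed_sum_def
      by (intro sums_add sums_mult summable_sums log_laplace_kernel g_summable x d)
    moreover have "(if d * u n \<le> \<alpha> then x n else 0) 
      \<le> x n * g (exp (- d * u n)) + e / 3 * (x n * (exp (- d * u n) - exp (- d * u n) ^ 2))" for n
    proof -
      have "exp (- d * u n) \<in> {0..1}" using d x by (auto simp: log_laplace_def)
      from mult_left_mono[OF c(1)[OF this], of "x n"] 
      have "x n * of_bool (d * u n \<le> \<alpha>) \<le> x n * (g (exp (- d * u n)) + e / 3 * (exp (- d * u n) - exp (- d * u n) ^ 2))"
        using x by (simp add: log_laplace_def g_def)
      thus ?thesis by (auto simp: algebra_simps)
    qed
    ultimately show ?thesis unfolding counting_sum_def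
      by (intro sums_le[OF _ summable_sums]) (auto intro: log_laplace_summable_counting x d)
  qed
  have upper: "smoothed_sum y w g d \<le> counting_sum y w \<beta> d + e / 3 * smoothed_sum y w (\<lambda>v. v - v ^ 2) d" if d: "d > 0" for d
  proof -
    have "(\<lambda>n. (if d * w n \<le> \<beta> then y n else 0) + e / 3 * (y n * (exp (- d * w n) - exp (- d * w n) ^ 2))) sums
      (counting_sum y w \<beta> d + e / 3 * smoothed_sum y w (\<lambda>v. v - v ^ 2) d)"
      unfolding smoothed_sum_def counting_sum_def
      by (intro sums_add sums_mult summable_sums log_laplace_kernel log_laplace_summable_counting y d)
    moreover have "y n * g (exp (- d * w n)) \<le>
      (if d * w n \<le> \<beta> then y n else 0) + e / 3 * (y n * (exp (- d * w n) - exp (- d * w n) ^ 2))" for n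
    proof -
      have "exp (- d * w n) \<in> {0..1}" using d y by (auto simp: log_laplace_def)
      from mult_left_mono[OF c(2)[OF this], of "y n"] 
      have "y n * g (exp (- d * w n)) \<le> y n * (of_bool (d * w n \<le> \<beta>) + e / 3 * (exp (- d * w n) - exp (- d * w n) ^ 2))"
        using y by (simp add: log_laplace_def g_def)
      thus ?thesis by (auto simp: algebra_simps)
    qed
    ultimately show ?thesis unfolding smoothed_sum_def[of _ _ g]
      by (rule sums_le[OF _ summable_sums[OF g_summable[OF y d]], rotated])
  qed
  have "((\<lambda>d. (smoothed_sum x u g d + ln d) - (smoothed_sum y w g d + ln d)) \<longlongrightarrow> 
     (\<Sum>i\<le>m. c i * (ln (real (Suc (Suc i))) - ln (real (Suc i)))) -
     (\<Sum>i\<le>m. c i * (ln (real (Suc (Suc i))) - ln (real (Suc i))))) (at_right 0)"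
    unfolding g_def by (intro tendsto_diff log_laplace_polynomial(2) x y)
  hence "eventually (\<lambda>d. (smoothed_sum x u g d + ln d) - (smoothed_sum y w g d + ln d) < e / 3) (at_right 0)"
    using assms by (intro order_tendstoD(2)) auto
  thus ?thesis
    using log_laplace_kernel(2)[OF x] log_laplace_kernel(2)[OF y] eventually_at_right_less[of 0]
  proof eventually_elim
    case (elim d)
    have "e / 3 * smoothed_sum x u (\<lambda>v. v - v ^ 2) d \<le> e / 3" "e / 3 * smoothed_sum y w (\<lambda>v. v - v ^ 2) d \<le> e / 3"
      using elim assms by (auto intro!: mult_left_le)
    thus ?case using lower[of d] upper[of d] elim by linarith
  qed
qed

section \<open>The harmonic measure as a reference\<close>

text \<open>The transform is the logarithmic series with value \<open>- ln (1 - exp (- d))\<close>;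
  the term at 0 vanishes because \<open>1 / 0 = 0\<close>.\<close>

lemma log_laplace_harmonic: "log_laplace (\<lambda>n. 1 / real n) real"
proof -
  have sums: "(\<lambda>n. 1 / real n * exp (- d * real n)) sums (- ln (1 - exp (- d)))" if "d > 0" for d
  proof -
    have "(\<lambda>n. - ((- (- exp (- d))) ^ n) / real n) sums ln (1 + (- exp (- d)))"
      using that by (intro ln_series') auto
    from sums_minus[OF this] show ?thesis
      by (simp add: exp_of_nat_mult[symmetric] mult_ac)
  qed
  have "((\<lambda>d::real. - ln (1 - exp (- d)) + ln d) \<longlongrightarrow> 0) (at_right 0)"
    by real_asymp
  moreover have "eventually (\<lambda>d. - ln (1 - exp (- d)) + ln d = (\<Sum>n. 1 / real n * exp (- d * real n)) + ln d) (at_right 0)"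
    using eventually_at_right_less[of 0] by eventually_elim (use sums in \<open>simp add: sums_iff\<close>)
  ultimately have "((\<lambda>d. (\<Sum>n. 1 / real n * exp (- d * real n)) + ln d) \<longlongrightarrow> 0) (at_right 0)"
    by (rule Lim_transform_eventually)
  thus ?thesis using sums by (auto simp: log_laplace_def sums_iff)
qed

text \<open>The counting sum is the harmonic number at the floor of \<open>\<beta> / d\<close>; the
  Euler-Mascheroni constant enters here through its definition as a limit.\<close>

lemma counting_sum_harmonic:
  assumes "\<beta> > 0"
  shows "((\<lambda>d. counting_sum (\<lambda>n. 1 / real n) real \<beta> d + ln d) \<longlongrightarrow> euler_mascheroni + ln \<beta>) (at_right 0)"
proof -
  have lim: "filterlim (\<lambda>d. nat \<lfloor>\<beta> / d\<rfloor>) at_top (at_right 0)"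
    using assms by real_asymp
  have "((\<lambda>d. harm (nat \<lfloor>\<beta> / d\<rfloor>) - ln (real (nat \<lfloor>\<beta> / d\<rfloor>))) \<longlongrightarrow> euler_mascheroni) (at_right 0)"
    using euler_mascheroni_LIMSEQ lim by (rule filterlim_compose)
  moreover have "((\<lambda>d. ln (real (nat \<lfloor>\<beta> / d\<rfloor>)) + ln d) \<longlongrightarrow> ln \<beta>) (at_right 0)"
    using assms by real_asymp
  ultimately have "((\<lambda>d. (harm (nat \<lfloor>\<beta> / d\<rfloor>) - ln (real (nat \<lfloor>\<beta> / d\<rfloor>))) + (ln (real (nat \<lfloor>\<beta> / d\<rfloor>)) + ln d))
    \<longlongrightarrow> euler_mascheroni + ln \<beta>) (at_right 0)"
    by (rule tendsto_add)
  moreover have "eventually (\<lambda>d. (harm (nat \<lfloor>\<beta> / d\<rfloor>) - ln (real (nat \<lfloor>\<beta> / d\<rfloor>))) + (ln (real (nat \<lfloor>\<beta> / d\<rfloor>)) + ln d)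
     = counting_sum (\<lambda>n. 1 / real n) real \<beta> d + ln d) (at_right 0)"
    using eventually_at_right_less[of 0]
  proof eventually_elim
    case (elim d)
    have "d * real n \<le> \<beta> \<longleftrightarrow> n \<le> nat \<lfloor>\<beta> / d\<rfloor>" for n
      using elim assms by (simp add: le_nat_iff le_floor_iff field_simps)
    hence "counting_sum (\<lambda>n. 1 / real n) real \<beta> d = (\<Sum>n. if n \<in> {..nat \<lfloor>\<beta> / d\<rfloor>} then 1 / real n else 0)"
      by (simp add: counting_sum_def)
    also have "\<dots> = (\<Sum>n\<le>nat \<lfloor>\<beta> / d\<rfloor>. 1 / real n)"
      by (rule sums_unique[symmetric], rule sums_If_finite_set) auto
    also have "\<dots> = harm (nat \<lfloor>\<beta> / d\<rfloor>)"
      unfolding harm_def by (intro sum.mono_neutral_cong_right) (auto simp: inverse_eq_divide)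
    finally show ?case by simp
  qed
  ultimately show ?thesis by (rule Lim_transform_eventually)
qed

text \<open>Comparison with the harmonic measure, whose cutoff \<open>t\<close> is moved slightly
  off 1; the shift costs only \<open>ln t\<close>. The three parts \<open>e\<close> of the error pay
  for this shift, the comparison and the harmonic limit.\<close>

theorem log_laplace_tauberian:
  assumes "log_laplace x u"
  shows "((\<lambda>d. counting_sum x u 1 d + ln d) \<longlongrightarrow> euler_mascheroni) (at_right 0)"
proof (rule order_tendstoI)
  let ?h = "counting_sum (\<lambda>n. 1 / real n) real"
  fix l :: real assume "l < euler_mascheroni"
  define e where "e = (euler_mascheroni - l) / 3"
  have e: "e > 0" "l = euler_mascheroni - 3 * e"
    using \<open>l < _\<close> by (auto simp: e_def field_simps)
  have "((\<lambda>t. ln t) \<longlongrightarrow> ln 1) (at_left (1::real))" by (intro tendsto_intros) auto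
  hence "eventually (\<lambda>t. ln t > - e) (at_left (1::real))"
    using e by (intro order_tendstoD) auto
  moreover have "eventually (\<lambda>t. t \<in> {0<..<1}) (at_left (1::real))"
    by (intro eventually_at_leftI[of 0]) auto
  ultimately have "eventually (\<lambda>t. ln t > - e \<and> t \<in> {0<..<1}) (at_left (1::real))"
    by (rule eventually_conj)
  then obtain t where t: "ln t > - e" "0 < t" "t < 1"
    using eventually_happens[of _ "at_left (1::real)"] by (auto simp: trivial_limit_at_left_real)
  have "eventually (\<lambda>d. ?h t d \<le> counting_sum x u 1 d + e) (at_right 0)"
    by (intro log_laplace_compare log_laplace_harmonic assms t e)
  moreover have "eventually (\<lambda>d. ?h t d + ln d > euler_mascheroni + ln t - e) (at_right 0)"
    using counting_sum_harmonic[OF t(2)] e by (intro order_tendstoD(1)) auto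
  ultimately show "eventually (\<lambda>d. l < counting_sum x u 1 d + ln d) (at_right 0)"
    by eventually_elim (use t e in auto)
next
  let ?h = "counting_sum (\<lambda>n. 1 / real n) real"
  fix l :: real assume "euler_mascheroni < l"
  define e where "e = (l - euler_mascheroni) / 3"
  have e: "e > 0" "l = euler_mascheroni + 3 * e"
    using \<open>_ < l\<close> by (auto simp: e_def field_simps)
  \<comment> \<open>Chosen so that \<open>ln (1 + e) \<le> e\<close> bounds the shift.\<close>
  define t where "t = 1 + e"
  have t: "t > 1" "t > 0" "ln t \<le> e" using e ln_add_one_self_le_self[of e] by (auto simp: t_def)
  have "eventually (\<lambda>d. counting_sum x u 1 d \<le> ?h t d + e) (at_right 0)"
    by (intro log_laplace_compare log_laplace_harmonic assms t e) auto
  moreover have "eventually (\<lambda>d. ?h t d + ln d < euler_mascheroni + ln t + e) (at_right 0)"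
    using counting_sum_harmonic[OF t(2)] e by (intro order_tendstoD(2)) auto
  ultimately show "eventually (\<lambda>d. counting_sum x u 1 d + ln d < l) (at_right 0)"
    by eventually_elim (use t e in auto)
qed

section \<open>Mertens' theorem and the upper limit\<close>

lemma prime_weight_log_laplace: "log_laplace prime_weight (\<lambda>n. ln (real n))"
proof -
  \<comment> \<open>The case \<open>n = 0\<close> rests on the default value
    \<open>ln 0 = 0\<close>.\<close>
  have "0 \<le> ln (real n)" for n by (cases "n = 0") auto
  thus ?thesis
    using prime_weight_bounds(1) summable_prime_weight prime_weight_laplace by (simp add: log_laplace_def)
qed

text \<open>The Tauberian theorem at \<open>d = 1 / ln N\<close>: the cutoff
  \<open>d * ln n \<le> 1\<close> means \<open>n \<le> N\<close>, and
  \<open>ln d = - ln (ln N)\<close>.\<close>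

lemma mertens_third_log:
  "(\<lambda>N. (\<Sum>n\<le>N. prime_weight n) - ln (ln (real N))) \<longlonglongrightarrow> euler_mascheroni"
proof -
  have "filterlim (\<lambda>N. 1 / ln (real N)) (at_right 0) sequentially"
    by real_asymp
  from filterlim_compose[OF log_laplace_tauberian[OF prime_weight_log_laplace] this]
  have "(\<lambda>N. counting_sum prime_weight (\<lambda>n. ln (real n)) 1 (1 / ln (real N)) + ln (1 / ln (real N)))
          \<longlonglongrightarrow> euler_mascheroni" .
  moreover have "eventually (\<lambda>N. counting_sum prime_weight (\<lambda>n. ln (real n)) 1 (1 / ln (real N)) + ln (1 / ln (real N))
      = (\<Sum>n\<le>N. prime_weight n) - ln (ln (real N))) sequentially"
  proof (rule eventually_sequentiallyI)
    fix N :: nat assume N: "2 \<le> N"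
    have "(if 1 / ln (real N) * ln (real n) \<le> 1 then prime_weight n else 0) = (if n \<in> {..N} then prime_weight n else 0)" for n
    proof (cases "n = 0")
      case False
      thus ?thesis using N by (auto simp: field_simps)
    qed (use N in \<open>auto simp: prime_weight_def\<close>)
    hence "counting_sum prime_weight (\<lambda>n. ln (real n)) 1 (1 / ln (real N)) = (\<Sum>n. if n \<in> {..N} then prime_weight n else 0)"
      by (simp add: counting_sum_def)
    also have "\<dots> = (\<Sum>n\<le>N. prime_weight n)"
      by (rule sums_unique[symmetric], rule sums_If_finite_set) auto
    finally show "counting_sum prime_weight (\<lambda>n. ln (real n)) 1 (1 / ln (real N)) + ln (1 / ln (real N))
      = (\<Sum>n\<le>N. prime_weight n) - ln (ln (real N))"
      using N by (simp add: ln_div)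
  qed
  ultimately show ?thesis by (rule Lim_transform_eventually)
qed

text \<open>Each factor \<open>1 + 1 / p\<close> is \<open>1 - 1 / p^2\<close> divided by
  \<open>1 - 1 / p\<close>. The first part tends to \<open>1 / real_zeta 2\<close>, the second is
  Mertens' product.\<close>

lemma prod_primes_one_plus_asymp:
  "(\<lambda>N. (\<Prod>p | prime p \<and> p \<le> N. 1 + 1 / real p) / ln (real N)) \<longlonglongrightarrow> 6 / pi\<^sup>2 * exp euler_mascheroni"
proof -
  have "(\<lambda>N. (\<Prod>p | prime p \<and> p \<le> N. 1 - real p powr -2) * exp ((\<Sum>n\<le>N. prime_weight n) - ln (ln (real N))))
     \<longlonglongrightarrow> 1 / real_zeta 2 * exp euler_mascheroni"
    by (intro tendsto_mult euler_product_LIMSEQ tendsto_exp mertens_third_log) auto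
  moreover have "eventually (\<lambda>N. (\<Prod>p | prime p \<and> p \<le> N. 1 - real p powr -2) * exp ((\<Sum>n\<le>N. prime_weight n) - ln (ln (real N)))
     = (\<Prod>p | prime p \<and> p \<le> N. 1 + 1 / real p) / ln (real N)) sequentially"
  proof (rule eventually_sequentiallyI)
    fix N :: nat assume N: "2 \<le> N"
    have "(\<Sum>n\<le>N. prime_weight n) = (\<Sum>p | prime p \<and> p \<le> N. - ln (1 - 1 / real p))"
      unfolding prime_weight_def by (subst sum.inter_filter[symmetric]) (auto intro!: sum.cong)
    hence "exp (\<Sum>n\<le>N. prime_weight n) = (\<Prod>p | prime p \<and> p \<le> N. exp (- ln (1 - 1 / real p)))"
      by (simp add: exp_sum)
    moreover have "(1 - real p powr -2) * exp (- ln (1 - 1 / real p)) = 1 + 1 / real p" if "prime p" for p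
    proof -
      have "1 - 1 / real p > 0" using prime_gt_1_nat[OF that] by simp
      hence "exp (- ln (1 - 1 / real p)) = 1 / (1 - 1 / real p)" by (simp add: exp_minus inverse_eq_divide)
      moreover have "1 - real p powr -2 = (1 + 1 / real p) * (1 - 1 / real p)"
        using prime_gt_0_nat[OF that] by (simp add: powr_minus_divide powr_numeral algebra_simps power2_eq_square)
      ultimately show ?thesis using \<open>1 - 1 / real p > 0\<close> by (metis less_irrefl nonzero_mult_div_cancel_right times_divide_eq_right mult_1_right)
    qed
    ultimately have "(\<Prod>p | prime p \<and> p \<le> N. 1 - real p powr -2) * exp (\<Sum>n\<le>N. prime_weight n)
      = (\<Prod>p | prime p \<and> p \<le> N. 1 + 1 / real p)"
      by (simp add: prod.distrib[symmetric])
    thus "(\<Prod>p | prime p \<and> p \<le> N. 1 - real p powr -2) * exp ((\<Sum>n\<le>N. prime_weight n) - ln (ln (real N)))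
     = (\<Prod>p | prime p \<and> p \<le> N. 1 + 1 / real p) / ln (real N)"
      using N by (simp add: exp_diff)
  qed
  ultimately show ?thesis
    unfolding real_zeta_2 by (simp add: Lim_transform_eventually)
qed

text \<open>The prime factors above \<open>ln n\<close> have a product of at most \<open>n\<close>,
  which bounds their number by \<open>ln n / ln (ln n)\<close>. Each contributes at most
  \<open>exp (1 / ln n)\<close>.\<close>

lemma prod_prime_factors_le:
  assumes "ln (real n) > 1"
  shows "(\<Prod>p\<in>prime_factors n. 1 + 1 / real p)
    \<le> (\<Prod>p | prime p \<and> p \<le> nat \<lfloor>ln (real n)\<rfloor>. 1 + 1 / real p) * exp (1 / ln (ln (real n)))"
proof -
  have n: "n > 0" using assms by (auto intro!: Nat.gr0I)
  define S where "S = {p \<in> prime_factors n. real p \<le> ln (real n)}"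
  define L where "L = {p \<in> prime_factors n. real p > ln (real n)}"
  have fin: "finite S" "finite L" by (auto simp: S_def L_def)
  have union: "prime_factors n = S \<union> L" "S \<inter> L = {}" by (auto simp: S_def L_def)
  have "\<Prod>L dvd \<Prod>(prime_factors n)"
    by (intro prod_dvd_prod_subset) (auto simp: L_def)
  also have "\<dots> dvd (\<Prod>p\<in>prime_factors n. p ^ multiplicity p n)"
    by (intro prod_dvd_prod) (auto intro!: dvd_power simp: prime_factors_multiplicity)
  also have "\<dots> = n" using n by (simp add: prod_prime_factors)
  finally have Ln: "\<Prod>L \<le> n" using n by (simp add: dvd_imp_le)
  have "ln (real n) ^ card L = (\<Prod>p\<in>L. ln (real n))" by simp
  also have "\<dots> \<le> (\<Prod>p\<in>L. real p)"
    using assms by (intro prod_mono) (auto simp: L_def)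
  also have "\<dots> \<le> real n" using Ln by (simp flip: of_nat_prod)
  finally have "ln (ln (real n) ^ card L) \<le> ln (real n)"
    using assms by (intro ln_mono) auto
  hence card: "real (card L) * ln (ln (real n)) \<le> ln (real n)"
    using assms by (simp add: ln_realpow)
  have "(\<Prod>p\<in>L. 1 + 1 / real p) \<le> (\<Prod>p\<in>L. exp (1 / ln (real n)))"
  proof (intro prod_mono conjI)
    fix p assume "p \<in> L"
    hence "1 / real p \<le> 1 / ln (real n)" using assms by (auto simp: L_def intro!: divide_left_mono)
    thus "1 + 1 / real p \<le> exp (1 / ln (real n))" by (rule order_trans[OF add_left_mono exp_ge_add_one_self])
  qed auto
  also have "\<dots> = exp (1 / ln (real n)) ^ card L" by (rule prod_constant)
  also have "\<dots> = exp (real (card L) * (1 / ln (real n)))" by (rule exp_of_nat_mult[symmetric])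
  also have "\<dots> \<le> exp (1 / ln (ln (real n)))"
    using card assms by (simp add: field_simps)
  finally have L: "(\<Prod>p\<in>L. 1 + 1 / real p) \<le> exp (1 / ln (ln (real n)))" .
  have S: "(\<Prod>p\<in>S. 1 + 1 / real p) \<le> (\<Prod>p | prime p \<and> p \<le> nat \<lfloor>ln (real n)\<rfloor>. 1 + 1 / real p)"
  proof (rule prod_mono2)
    show "S \<subseteq> {p. prime p \<and> p \<le> nat \<lfloor>ln (real n)\<rfloor>}"
      using assms by (auto simp: S_def le_nat_iff le_floor_iff)
  qed auto
  have "(\<Prod>p\<in>prime_factors n. 1 + 1 / real p) = (\<Prod>p\<in>S. 1 + 1 / real p) * (\<Prod>p\<in>L. 1 + 1 / real p)"
    unfolding union(1) using fin union(2) by (rule prod.union_disjoint)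
  also have "\<dots> \<le> (\<Prod>p | prime p \<and> p \<le> nat \<lfloor>ln (real n)\<rfloor>. 1 + 1 / real p) * exp (1 / ln (ln (real n)))"
    by (intro mult_mono S L prod_nonneg) auto
  finally show ?thesis .
qed

text \<open>Mertens' asymptotics at the floor of \<open>ln n\<close>; rounding and the exponential
  factor disappear in the limit.\<close>

lemma prod_primes_upper_limit:
  "(\<lambda>n. (\<Prod>p | prime p \<and> p \<le> nat \<lfloor>ln (real n)\<rfloor>. 1 + 1 / real p) * exp (1 / ln (ln (real n))) / ln (ln (real n)))
     \<longlonglongrightarrow> 6 / pi\<^sup>2 * exp euler_mascheroni"
proof -
  have "filterlim (\<lambda>n. nat \<lfloor>ln (real n)\<rfloor>) at_top sequentially" by real_asymp
  from filterlim_compose[OF prod_primes_one_plus_asymp this]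
  have 1: "(\<lambda>n. (\<Prod>p | prime p \<and> p \<le> nat \<lfloor>ln (real n)\<rfloor>. 1 + 1 / real p) / ln (real (nat \<lfloor>ln (real n)\<rfloor>)))
     \<longlonglongrightarrow> 6 / pi\<^sup>2 * exp euler_mascheroni" .
  have 2: "(\<lambda>n. ln (real (nat \<lfloor>ln (real n)\<rfloor>)) * (exp (1 / ln (ln (real n))) / ln (ln (real n)))) \<longlonglongrightarrow> 1"
    by real_asymp
  have 3: "eventually (\<lambda>n. ln (real (nat \<lfloor>ln (real n)\<rfloor>)) > 0) sequentially"
    by real_asymp
  have "(\<lambda>n. (\<Prod>p | prime p \<and> p \<le> nat \<lfloor>ln (real n)\<rfloor>. 1 + 1 / real p) / ln (real (nat \<lfloor>ln (real n)\<rfloor>)) *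
     (ln (real (nat \<lfloor>ln (real n)\<rfloor>)) * (exp (1 / ln (ln (real n))) / ln (ln (real n)))))
     \<longlonglongrightarrow> 6 / pi\<^sup>2 * exp euler_mascheroni * 1"
    by (rule tendsto_mult[OF 1 2])
  moreover have "eventually (\<lambda>n. (\<Prod>p | prime p \<and> p \<le> nat \<lfloor>ln (real n)\<rfloor>. 1 + 1 / real p) / ln (real (nat \<lfloor>ln (real n)\<rfloor>)) *
     (ln (real (nat \<lfloor>ln (real n)\<rfloor>)) * (exp (1 / ln (ln (real n))) / ln (ln (real n))))
     = (\<Prod>p | prime p \<and> p \<le> nat \<lfloor>ln (real n)\<rfloor>. 1 + 1 / real p) * exp (1 / ln (ln (real n))) / ln (ln (real n))) sequentially"
    using 3 by eventually_elim simp
  ultimately show ?thesis by (simp add: Lim_transform_eventually)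
qed

section \<open>Primorials and the upper limit\<close>

definition primorial :: "nat \<Rightarrow> nat" where
  "primorial N = \<Prod>{p. prime p \<and> p \<le> N}"

lemma primorial_at_top: "filterlim primorial at_top sequentially"
  unfolding filterlim_at_top
proof
  fix Z :: nat
  obtain q where q: "prime q" "q > Z" using bigger_prime by blast
  have "Z \<le> primorial N" if "q \<le> N" for N
  proof -
    have "q dvd primorial N"
      unfolding primorial_def using q that by (intro dvd_prodI) auto
    moreover have "primorial N > 0"
      unfolding primorial_def by (intro prod_pos) (auto simp: prime_gt_0_nat)
    ultimately show ?thesis using q dvd_imp_le[of q "primorial N"] by linarith
  qed
  thus "eventually (\<lambda>N. Z \<le> primorial N) sequentially"
    by (rule eventually_sequentiallyI)
qed

text \<open>Crude but sufficient: after one more logarithm, \<open>ln (N * ln N)\<close> is still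
  asymptotic to \<open>ln N\<close>.\<close>

lemma ln_primorial_le:
  assumes "N \<ge> 1"
  shows "ln (real (primorial N)) \<le> real N * ln (real N)"
proof -
  have "primorial N \<le> (\<Prod>p | prime p \<and> p \<le> N. N)"
    unfolding primorial_def by (intro prod_mono) auto
  also have "\<dots> = N ^ card {p. prime p \<and> p \<le> N}" by simp
  also have "card {p. prime p \<and> p \<le> N} \<le> card {1..N}"
    by (intro card_mono) (auto dest: prime_gt_0_nat)
  hence "N ^ card {p. prime p \<and> p \<le> N} \<le> N ^ N" using assms by (intro power_increasing) auto
  finally have "real (primorial N) \<le> real N ^ N" by (metis of_nat_le_iff of_nat_power)
  moreover have "primorial N > 0"
    unfolding primorial_def by (intro prod_pos) (auto simp: prime_gt_0_nat)
  ultimately have "ln (real (primorial N)) \<le> ln (real N ^ N)" by (intro ln_mono) auto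
  thus ?thesis using assms by (simp add: ln_realpow)
qed

lemma limsup_eqI:
  fixes f U L :: "nat \<Rightarrow> real" and g :: "nat \<Rightarrow> nat"
  assumes "eventually (\<lambda>n. f n \<le> U n) sequentially" "U \<longlonglongrightarrow> C"
    and "filterlim g at_top sequentially" "eventually (\<lambda>n. L n \<le> f (g n)) sequentially" "L \<longlonglongrightarrow> C"
  shows "limsup (\<lambda>n. ereal (f n)) = ereal C"
proof (rule antisym)
  have "limsup (\<lambda>n. ereal (f n)) \<le> limsup (\<lambda>n. ereal (U n))"
    by (intro Limsup_mono) (use assms(1) in simp)
  also have "\<dots> = ereal C"
    using assms(2) by (intro lim_imp_Limsup) auto
  finally show "limsup (\<lambda>n. ereal (f n)) \<le> ereal C" .
  show "ereal C \<le> limsup (\<lambda>n. ereal (f n))"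
  proof (rule ccontr)
    assume "\<not> ereal C \<le> limsup (\<lambda>n. ereal (f n))"
    then obtain y where y: "limsup (\<lambda>n. ereal (f n)) < ereal y" "ereal y < ereal C"
      by (metis ereal_dense2 not_le)
    have "eventually (\<lambda>n. ereal (f n) < ereal y) sequentially"
      using y(1) by (rule Limsup_lessD)
    hence "eventually (\<lambda>n. f (g n) < y) sequentially"
      using assms(3) by (auto simp: filterlim_iff)
    moreover have "eventually (\<lambda>n. L n > y) sequentially"
      using assms(5) y(2) by (intro order_tendstoD) auto
    ultimately have "eventually (\<lambda>n. False) sequentially"
      using assms(4) by eventually_elim auto
    thus False by simp
  qed
qed

text \<open>Treats \<open>divisor_sum\<close> and \<open>dedekind_psi\<close> together, through the
  upper bound they share and their common value at primorials.\<close>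

lemma limsup_arith_quotient:
  fixes h :: "nat \<Rightarrow> real"
  assumes upper: "\<And>n. n > 0 \<Longrightarrow> real (varrho n) * h n \<le> real n ^ 2 * (\<Prod>p\<in>prime_factors n. 1 + 1 / real p)"
    and primorial: "\<And>N. h (primorial N) = real (primorial N) * (\<Prod>p | prime p \<and> p \<le> N. 1 + 1 / real p)"
  shows "limsup (\<lambda>n. ereal (real (varrho n) * h n / (real n ^ 2 * ln (ln (real n))))) = ereal (6 / pi\<^sup>2 * exp euler_mascheroni)"
proof (rule limsup_eqI[OF _ prod_primes_upper_limit primorial_at_top])
  have "eventually (\<lambda>n. ln (real n) > 1) sequentially" by real_asymp
  thus "eventually (\<lambda>n. real (varrho n) * h n / (real n ^ 2 * ln (ln (real n)))
     \<le> (\<Prod>p | prime p \<and> p \<le> nat \<lfloor>ln (real n)\<rfloor>. 1 + 1 / real p) * exp (1 / ln (ln (real n))) / ln (ln (real n))) sequentially"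
  proof eventually_elim
    case (elim n)
    have n: "n > 0" using elim by (auto intro!: Nat.gr0I)
    have "real (varrho n) * h n / real n ^ 2 \<le> (\<Prod>p\<in>prime_factors n. 1 + 1 / real p)"
      using upper[OF n] n by (simp add: field_simps)
    also note prod_prime_factors_le[OF elim]
    finally have "real (varrho n) * h n / real n ^ 2 / ln (ln (real n))
      \<le> (\<Prod>p | prime p \<and> p \<le> nat \<lfloor>ln (real n)\<rfloor>. 1 + 1 / real p) * exp (1 / ln (ln (real n))) / ln (ln (real n))"
      using elim by (intro divide_right_mono) auto
    thus ?case by simp
  qed
  let ?Q = "\<lambda>N. \<Prod>p | prime p \<and> p \<le> N. 1 + 1 / real p"
  have "eventually (\<lambda>n. ln (real n) > 1) sequentially" by real_asymp
  hence "eventually (\<lambda>N. ln (real (primorial N)) > 1) sequentially"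
    using primorial_at_top by (auto simp: filterlim_iff)
  thus "eventually (\<lambda>N. ?Q N / ln (real N * ln (real N))
     \<le> real (varrho (primorial N)) * h (primorial N) / (real (primorial N) ^ 2 * ln (ln (real (primorial N))))) sequentially"
    using eventually_ge_at_top[of 2]
  proof eventually_elim
    case (elim N)
    have pos: "real (primorial N) > 0" using elim(1) by (cases "primorial N = 0") auto
    \<comment> \<open>Primorials are squarefree, so every residue is regular and the quotient is
      exactly the prime product over the iterated logarithm.\<close>
    have "varrho (primorial N) = primorial N"
      unfolding primorial_def by (intro varrho_squarefree squarefree_prod_primes) auto
    hence "real (varrho (primorial N)) * h (primorial N) / (real (primorial N) ^ 2 * ln (ln (real (primorial N))))
      = ?Q N / ln (ln (real (primorial N)))"
      using pos by (simp add: primorial power2_eq_square)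
    also have "\<dots> \<ge> ?Q N / ln (real N * ln (real N))"
    proof (intro divide_left_mono ln_mono prod_nonneg)
      show "ln (real (primorial N)) \<le> real N * ln (real N)" using elim by (intro ln_primorial_le) auto
      thus "0 < ln (real N * ln (real N)) * ln (ln (real (primorial N)))"
        using elim by (intro mult_pos_pos) auto
    qed (use elim in auto)
    finally show ?case .
  qed
  have "(\<lambda>N. ?Q N / ln (real N) * (ln (real N) / ln (real N * ln (real N)))) \<longlonglongrightarrow> 6 / pi\<^sup>2 * exp euler_mascheroni * 1"
    by (intro tendsto_mult prod_primes_one_plus_asymp) real_asymp
  moreover have "eventually (\<lambda>N. ?Q N / ln (real N) * (ln (real N) / ln (real N * ln (real N)))
      = ?Q N / ln (real N * ln (real N))) sequentially"
    using eventually_ge_at_top[of 2] by eventually_elim auto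
  ultimately show "(\<lambda>N. ?Q N / ln (real N * ln (real N))) \<longlonglongrightarrow> 6 / pi\<^sup>2 * exp euler_mascheroni"
    by (simp add: Lim_transform_eventually)
qed

theorem proposition6p1:
  shows "limsup (\<lambda>n::nat. ereal (real (varrho n) * real (divisor_sum n) / (real n ^ 2 * ln (ln (real n)))))
           = ereal (6 / pi\<^sup>2 * exp euler_mascheroni)
       \<and> limsup (\<lambda>n::nat. ereal (real (varrho n) * dedekind_psi n / (real n ^ 2 * ln (ln (real n)))))
           = ereal (6 / pi\<^sup>2 * exp euler_mascheroni)"
proof
  show "limsup (\<lambda>n::nat. ereal (real (varrho n) * real (divisor_sum n) / (real n ^ 2 * ln (ln (real n)))))
           = ereal (6 / pi\<^sup>2 * exp euler_mascheroni)"
  proof (rule limsup_arith_quotient)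
    show "real (divisor_sum (primorial N)) = real (primorial N) * (\<Prod>p | prime p \<and> p \<le> N. 1 + 1 / real p)" for N
      unfolding primorial_def by (rule divisor_sum_prod_primes) auto
  qed (rule varrho_divisor_sum_le)
  show "limsup (\<lambda>n::nat. ereal (real (varrho n) * dedekind_psi n / (real n ^ 2 * ln (ln (real n)))))
           = ereal (6 / pi\<^sup>2 * exp euler_mascheroni)"
  proof (rule limsup_arith_quotient)
    fix n :: nat
    \<comment> \<open>The Dedekind function already contains the product, so
      \<open>varrho_le\<close> suffices.\<close>
    show "real (varrho n) * dedekind_psi n \<le> real n ^ 2 * (\<Prod>p\<in>prime_factors n. 1 + 1 / real p)"
      unfolding dedekind_psi_def power2_eq_square mult.assoc
      by (intro mult_right_mono) (auto intro!: mult_nonneg_nonneg prod_nonneg simp: varrho_le)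
  next
    fix N :: nat
    have "prime_factors (primorial N) = {p. prime p \<and> p \<le> N}"
      unfolding primorial_def by (rule prime_factors_prod_primes) auto
    thus "dedekind_psi (primorial N) = real (primorial N) * (\<Prod>p | prime p \<and> p \<le> N. 1 + 1 / real p)"
      by (simp add: dedekind_psi_def)
  qed
qed

end
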